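(* Let $R$ be a ring with a right noetherian point annihilator set $\mathcal{S}$ that is closed under similarity (such as the set of all cocritical right ideals of $R$). Then $R$ is a principal right ideal ring if and only if every essential right ideal of $R$ lying in $\mathcal{S}$ is principal.
   Context: Rings are associative with identity; modules are unital right modules. A principal right ideal ring is a ring in which every right ideal is principal (of the form $xR$). A right ideal is essential if it is an essential submodule of $R_R$. Right ideals $I, J$ of $R$ are similar if $R/I \cong R/J$ as right $R$-modules; a set $\mathcal{S}$ of right ideals is closed under similarity if any right ideal similar to a member of $\mathcal{S}$ is in $\mathcal{S}$. A point annihilator of a right module $M$ is the annihilator $\mathrm{ann}(m)=\{r\in R: mr=0\}$ of some nonzero $m \in M$. A set $\mathcal{S}$ of right ideals of $R$ is a right noetherian point annihilator set for $R$ if every nonzero noetherian right $R$-module has a point annihilator lying in $\mathcal{S}$ (members of $\mathcal{S}$ are otherwise arbitrary). Krull dimension here is the Gabriel–Rentschler Krull dimension: $\mathcal{K}_{-1}$ is the class consisting of the zero module; for an ordinal $\alpha \ge 0$, $\mathcal{K}_\alpha$ is the class of modules $M$ such that for every descending chain $M_0 \supseteq M_1 \supseteq \cdots$ of submodules of $M$, $M_i/M_{i+1} \in \bigcup_{\beta<\alpha}\mathcal{K}_\beta$ for all but finitely many $i$; $\mathrm{K.dim}(M)$ is the least $\alpha$ (where $-1$ counts as an ordinal) with $M \in \mathcal{K}_\alpha$, if it exists. A module $M$ is $\alpha$-critical ($\alpha \geq 0$ an ordinal) if $\mathrm{K.dim}(M) = \alpha$ and $\mathrm{K.dim}(M/N)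 < \alpha$ for every nonzero submodule $N$ of $M$; it is critical if it is $\alpha$-critical for some $\alpha$. A right ideal $I$ of $R$ is cocritical if the right module $R/I$ is critical. *)

theory Defs
  imports "HOL-Algebra.AbelCoset"
begin

section \<open>Right modules\<close>

text \<open>
  The library's modules are over commutative rings and have scalars on the left.  As for the library's
  modules, the multiplicative fields inherited from the ring record carry no meaning for a module.
\<close>

record ('a, 'm) right_mod = "'m ring" +
  ract :: "'m \<Rightarrow> 'a \<Rightarrow> 'm"  (infixl "\<triangleleft>\<index>" 70)

locale right_module = R?: ring R + M?: abelian_group M
  for R :: "('a, 'k) ring_scheme" (structure) and M :: "('a, 'm, 'l) right_mod_scheme" (structure) +
  assumes ract_closed: "\<lbrakk>x \<in> carrier M; r \<in> carrier R\<rbrakk> \<Longrightarrow> x \<triangleleft>\<^bsub>M\<^esub> r \<in> carrier M"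
    and ract_add_left: "\<lbrakk>x \<in> carrier M; y \<in> carrier M; r \<in> carrier R\<rbrakk>
      \<Longrightarrow> (x \<oplus>\<^bsub>M\<^esub> y) \<triangleleft>\<^bsub>M\<^esub> r = x \<triangleleft>\<^bsub>M\<^esub> r \<oplus>\<^bsub>M\<^esub> y \<triangleleft>\<^bsub>M\<^esub> r"
    and ract_add_right: "\<lbrakk>x \<in> carrier M; r \<in> carrier R; s \<in> carrier R\<rbrakk>
      \<Longrightarrow> x \<triangleleft>\<^bsub>M\<^esub> (r \<oplus>\<^bsub>R\<^esub> s) = x \<triangleleft>\<^bsub>M\<^esub> r \<oplus>\<^bsub>M\<^esub> x \<triangleleft>\<^bsub>M\<^esub> s"
    and ract_mult: "\<lbrakk>x \<in> carrier M; r \<in> carrier R; s \<in> carrier R\<rbrakk>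
      \<Longrightarrow> x \<triangleleft>\<^bsub>M\<^esub> (r \<otimes>\<^bsub>R\<^esub> s) = (x \<triangleleft>\<^bsub>M\<^esub> r) \<triangleleft>\<^bsub>M\<^esub> s"
    and ract_one: "x \<in> carrier M \<Longrightarrow> x \<triangleleft>\<^bsub>M\<^esub> \<one>\<^bsub>R\<^esub> = x"

definition right_submodule ::
    "('a, 'k) ring_scheme \<Rightarrow> 'm set \<Rightarrow> ('a, 'm, 'l) right_mod_scheme \<Rightarrow> bool" where
  "right_submodule R N M \<longleftrightarrow>
     subgroup N (add_monoid M) \<and> (\<forall>x\<in>N. \<forall>r\<in>carrier R. x \<triangleleft>\<^bsub>M\<^esub> r \<in> N)"

definition zero_module :: "('a, 'm, 'l) right_mod_scheme \<Rightarrow> bool" where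
  "zero_module M \<longleftrightarrow> carrier M = {\<zero>\<^bsub>M\<^esub>}"

definition essential_submodule ::
    "('a, 'k) ring_scheme \<Rightarrow> 'm set \<Rightarrow> ('a, 'm, 'l) right_mod_scheme \<Rightarrow> bool" where
  "essential_submodule R N M \<longleftrightarrow>
     right_submodule R N M \<and>
     (\<forall>K. right_submodule R K M \<and> K \<noteq> {\<zero>\<^bsub>M\<^esub>} \<longrightarrow> N \<inter> K \<noteq> {\<zero>\<^bsub>M\<^esub>})"

definition quotient_module ::
    "('a, 'm, 'l) right_mod_scheme \<Rightarrow> 'm set \<Rightarrow> ('a, 'm set) right_mod" where
  "quotient_module M N =
     \<lparr>carrier = a_rcosets\<^bsub>M\<^esub> N, mult = undefined, one = undefined,
      zero = N, add = set_add M, ract = (\<lambda>X r. \<Union>x\<in>X. N +>\<^bsub>M\<^esub> (x \<triangleleft>\<^bsub>M\<^esub> r))\<rparr>"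

definition right_module_isomorphic ::
    "('a, 'k) ring_scheme \<Rightarrow> ('a, 'm, 'l) right_mod_scheme \<Rightarrow> ('a, 'n, 'j) right_mod_scheme \<Rightarrow> bool"
  where
  "right_module_isomorphic R M N \<longleftrightarrow>
     (\<exists>f \<in> iso (add_monoid M) (add_monoid N).
        \<forall>x\<in>carrier M. \<forall>r\<in>carrier R. f (x \<triangleleft>\<^bsub>M\<^esub> r) = f x \<triangleleft>\<^bsub>N\<^esub> r)"

definition noetherian_right_module ::
    "('a, 'k) ring_scheme \<Rightarrow> ('a, 'm, 'l) right_mod_scheme \<Rightarrow> bool" where
  "noetherian_right_module R M \<longleftrightarrow>
     right_module R M \<and>
     (\<forall>C :: nat \<Rightarrow> 'm set. (\<forall>i. right_submodule R (C i) M) \<and> (\<forall>i. C i \<subseteq> C (Suc i))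
        \<longrightarrow> (\<exists>n. \<forall>i\<ge>n. C i = C n))"

definition annihilator ::
    "('a, 'k) ring_scheme \<Rightarrow> ('a, 'm, 'l) right_mod_scheme \<Rightarrow> 'm \<Rightarrow> 'a set" where
  "annihilator R M m = {r \<in> carrier R. m \<triangleleft>\<^bsub>M\<^esub> r = \<zero>\<^bsub>M\<^esub>}"

definition point_annihilators ::
    "('a, 'k) ring_scheme \<Rightarrow> ('a, 'm, 'l) right_mod_scheme \<Rightarrow> 'a set set" where
  "point_annihilators R M = annihilator R M ` (carrier M - {\<zero>\<^bsub>M\<^esub>})"

section \<open>Right ideals\<close>

definition regular_module :: "('a, 'k) ring_scheme \<Rightarrow> ('a, 'a) right_mod" where
  "regular_module R =
     \<lparr>carrier = carrier R, mult = mult R, one = one R, zero = zero R, add = add R, ract = mult R\<rparr>"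

definition right_ideal :: "'a set \<Rightarrow> ('a, 'k) ring_scheme \<Rightarrow> bool" where
  "right_ideal I R \<longleftrightarrow> right_submodule R I (regular_module R)"

definition principal_right_ideal :: "'a set \<Rightarrow> ('a, 'k) ring_scheme \<Rightarrow> bool" where
  "principal_right_ideal I R \<longleftrightarrow> (\<exists>x\<in>carrier R. I = (\<lambda>r. x \<otimes>\<^bsub>R\<^esub> r) ` carrier R)"

definition principal_right_ideal_ring :: "('a, 'k) ring_scheme \<Rightarrow> bool" where
  "principal_right_ideal_ring R \<longleftrightarrow>
     ring R \<and> (\<forall>I. right_ideal I R \<longrightarrow> principal_right_ideal I R)"

definition essential_right_ideal :: "'a set \<Rightarrow> ('a, 'k) ring_scheme \<Rightarrow> bool" where
  "essential_right_ideal I R \<longleftrightarrow> essential_submodule R I (regular_module R)"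

definition similar_right_ideals :: "('a, 'k) ring_scheme \<Rightarrow> 'a set \<Rightarrow> 'a set \<Rightarrow> bool" where
  "similar_right_ideals R I J \<longleftrightarrow>
     right_ideal I R \<and> right_ideal J R \<and>
     right_module_isomorphic R
       (quotient_module (regular_module R) I) (quotient_module (regular_module R) J)"

definition closed_under_similarity :: "('a, 'k) ring_scheme \<Rightarrow> 'a set set \<Rightarrow> bool" where
  "closed_under_similarity R S \<longleftrightarrow> (\<forall>I\<in>S. \<forall>J. similar_right_ideals R J I \<longrightarrow> J \<in> S)"

text \<open>
  A hypothesis cannot quantify over the types of module elements.  The type \<open>(nat \<Rightarrow> 'a) set\<close> is large
  enough to lose nothing: a noetherian module is finitely generated, hence isomorphic to a quotient of
  some \<open>R\<^sup>n\<close>, whose elements are sets of \<open>n\<close>-tuples.  Lemma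
  \<open>right_noetherian_point_annihilator_setD\<close> below gives the property for modules over every type.
\<close>

definition right_noetherian_point_annihilator_set ::
    "('a, 'k) ring_scheme \<Rightarrow> 'a set set \<Rightarrow> bool" where
  "right_noetherian_point_annihilator_set R S \<longleftrightarrow>
     (\<forall>I\<in>S. right_ideal I R) \<and>
     (\<forall>M :: ('a, (nat \<Rightarrow> 'a) set) right_mod.
        noetherian_right_module R M \<and> \<not> zero_module M
        \<longrightarrow> (\<exists>I \<in> point_annihilators R M. I \<in> S))"

section \<open>Krull dimension\<close>

text \<open>
  Ordinals are represented by well-orders, up to order isomorphism, and compared by \<^const>\<open>ordLess\<close>
  (which includes that both sides are well-orders).  \<^term>\<open>None\<close> stands for \<open>-1\<close>.
\<close>

definition kord_less :: "'o rel option \<Rightarrow> 'o rel option \<Rightarrow> bool" where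
  "kord_less \<alpha> \<beta> \<longleftrightarrow>
     (case \<beta> of
        None \<Rightarrow> False
      | Some s \<Rightarrow> (case \<alpha> of None \<Rightarrow> Well_order s | Some r \<Rightarrow> (r, s) \<in> ordLess))"

text \<open>
  The elements of \<open>M\<^sub>i / M\<^sub>i\<^sub>+\<^sub>1\<close> are cosets, so this quotient does not have the element type of \<open>M\<close>;
  the classes being closed under isomorphism, its membership is expressed by an isomorphic module \<open>Q\<close>
  over the element type of \<open>M\<close> (one exists: transport the structure to coset representatives).
\<close>

inductive krull_class ::
    "('a, 'k) ring_scheme \<Rightarrow> 'o rel option \<Rightarrow> ('a, 'm) right_mod \<Rightarrow> bool"
  for R :: "('a, 'k) ring_scheme" where
  minus_one: "\<lbrakk>right_module R M; zero_module M\<rbrakk> \<Longrightarrow> krull_class R None M"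
| ordinal: "\<lbrakk>right_module R M; Well_order \<alpha>;
     \<And>C :: nat \<Rightarrow> 'm set.
       \<lbrakk>\<And>i. right_submodule R (C i) M; \<And>i. C (Suc i) \<subseteq> C i\<rbrakk>
       \<Longrightarrow> \<exists>n. \<forall>i\<ge>n. \<exists>\<beta> Q. kord_less \<beta> (Some \<alpha>) \<and> krull_class R \<beta> Q \<and>
             right_module_isomorphic R Q (quotient_module (M\<lparr>carrier := C i\<rparr>) (C (Suc i)))\<rbrakk>
   \<Longrightarrow> krull_class R (Some \<alpha>) M"

definition has_krull_dim ::
    "('a, 'k) ring_scheme \<Rightarrow> ('a, 'm) right_mod \<Rightarrow> 'o rel option \<Rightarrow> bool" where
  "has_krull_dim R M \<alpha> \<longleftrightarrow>
     krull_class R \<alpha> M \<and> (\<forall>\<beta>. kord_less \<beta> \<alpha> \<longrightarrow> \<not> krull_class R \<beta> M)"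

definition critical_of_dim ::
    "('a, 'k) ring_scheme \<Rightarrow> ('a, 'm) right_mod \<Rightarrow> 'o rel \<Rightarrow> bool" where
  "critical_of_dim R M \<alpha> \<longleftrightarrow>
     has_krull_dim R M (Some \<alpha>) \<and>
     (\<forall>N. right_submodule R N M \<and> N \<noteq> {\<zero>\<^bsub>M\<^esub>} \<longrightarrow>
        (\<exists>\<beta>. has_krull_dim R (quotient_module M N) \<beta> \<and> kord_less \<beta> (Some \<alpha>)))"

text \<open>
  Well-orders on subsets of the type \<open>'a set set\<close> represent all ordinals that matter here: if \<open>R/I\<close> has
  Krull dimension \<open>\<alpha>\<close>, every \<open>\<beta> < \<alpha>\<close> is the Krull dimension of some \<open>A/B\<close> with right ideals
  \<open>I \<subseteq> B \<subseteq> A\<close>, so \<open>\<alpha>\<close> has at most as many elements as there are pairs of subsets of \<open>R\<close>.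
\<close>

definition cocritical_right_ideal :: "'a set \<Rightarrow> ('a, 'k) ring_scheme \<Rightarrow> bool" where
  "cocritical_right_ideal I R \<longleftrightarrow>
     right_ideal I R \<and>
     (\<exists>\<alpha> :: 'a set set rel. critical_of_dim R (quotient_module (regular_module R) I) \<alpha>)"

section \<open>Independence of the element type\<close>

lemma right_submodule_closed:
  assumes "right_module R M" "right_submodule R U M"
  shows "\<zero>\<^bsub>M\<^esub> \<in> U" "U \<subseteq> carrier M"
    "\<And>x y. x \<in> U \<Longrightarrow> y \<in> U \<Longrightarrow> x \<oplus>\<^bsub>M\<^esub> y \<in> U"
    "\<And>x. x \<in> U \<Longrightarrow> \<ominus>\<^bsub>M\<^esub> x \<in> U"
    "\<And>x r. x \<in> U \<Longrightarrow> r \<in> carrier R \<Longrightarrow> x \<triangleleft>\<^bsub>M\<^esub> r \<in> U"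
proof -
  interpret right_module R M by (fact assms(1))
  interpret U: subgroup U "add_monoid M" using assms(2) by (simp add: right_submodule_def)
  show "\<zero>\<^bsub>M\<^esub> \<in> U" "U \<subseteq> carrier M"
    "\<And>x y. x \<in> U \<Longrightarrow> y \<in> U \<Longrightarrow> x \<oplus>\<^bsub>M\<^esub> y \<in> U"
    "\<And>x. x \<in> U \<Longrightarrow> \<ominus>\<^bsub>M\<^esub> x \<in> U"
    "\<And>x r. x \<in> U \<Longrightarrow> r \<in> carrier R \<Longrightarrow> x \<triangleleft>\<^bsub>M\<^esub> r \<in> U"
    using U.one_closed U.subset U.m_closed U.m_inv_closed assms(2)
    by (simp_all add: right_submodule_def a_inv_def)
qed

lemma right_submoduleI:
  assumes M: "right_module R M" and "\<zero>\<^bsub>M\<^esub> \<in> U" "U \<subseteq> carrier M"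
    "\<And>x y. x \<in> U \<Longrightarrow> y \<in> U \<Longrightarrow> x \<oplus>\<^bsub>M\<^esub> y \<in> U"
    "\<And>x r. x \<in> U \<Longrightarrow> r \<in> carrier R \<Longrightarrow> x \<triangleleft>\<^bsub>M\<^esub> r \<in> U"
  shows "right_submodule R U M"
proof -
  interpret right_module R M by (fact M)
  have neg: "\<ominus>\<^bsub>M\<^esub> x \<in> U" if x: "x \<in> U" for x
  proof -
    have xc: "x \<in> carrier M" using x assms by auto
    have "x \<triangleleft>\<^bsub>M\<^esub> \<zero>\<^bsub>R\<^esub> \<oplus>\<^bsub>M\<^esub> x \<triangleleft>\<^bsub>M\<^esub> \<zero>\<^bsub>R\<^esub> = x \<triangleleft>\<^bsub>M\<^esub> \<zero>\<^bsub>R\<^esub>"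
      using ract_add_right[OF xc, of "\<zero>\<^bsub>R\<^esub>" "\<zero>\<^bsub>R\<^esub>"] by simp
    then have z: "x \<triangleleft>\<^bsub>M\<^esub> \<zero>\<^bsub>R\<^esub> = \<zero>\<^bsub>M\<^esub>"
      using ract_closed[OF xc, of "\<zero>\<^bsub>R\<^esub>"] M.add.r_cancel_one by blast
    have "x \<triangleleft>\<^bsub>M\<^esub> (\<ominus>\<^bsub>R\<^esub> \<one>\<^bsub>R\<^esub>) \<oplus>\<^bsub>M\<^esub> x = \<zero>\<^bsub>M\<^esub>"
      using ract_add_right[OF xc, of "\<ominus>\<^bsub>R\<^esub> \<one>\<^bsub>R\<^esub>" "\<one>\<^bsub>R\<^esub>"] ract_one[OF xc] z
      by (simp add: R.l_neg)
    then have "\<ominus>\<^bsub>M\<^esub> x = x \<triangleleft>\<^bsub>M\<^esub> (\<ominus>\<^bsub>R\<^esub> \<one>\<^bsub>R\<^esub>)"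
      using xc ract_closed by (intro M.minus_equality) auto
    then show ?thesis using assms(5)[OF x, of "\<ominus>\<^bsub>R\<^esub> \<one>\<^bsub>R\<^esub>"] by simp
  qed
  show ?thesis
    unfolding right_submodule_def using assms neg
    by (auto intro!: M.add.subgroupI simp: a_inv_def)
qed

lemma noetherian_copy:
  fixes M :: "('a, 'm, 'l) right_mod_scheme" and \<phi> :: "'m \<Rightarrow> 'n"
  assumes noeth: "noetherian_right_module R M" and sub: "right_submodule R U M"
    and inj: "inj_on \<phi> U"
  obtains T :: "('a, 'n) right_mod"
  where "noetherian_right_module R T" "carrier T = \<phi> ` U" "\<zero>\<^bsub>T\<^esub> = \<phi> \<zero>\<^bsub>M\<^esub>"
    "\<And>x. x \<in> U \<Longrightarrow> annihilator R T (\<phi> x) = annihilator R M x"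
proof -
  have M: "right_module R M" using noeth by (simp add: noetherian_right_module_def)
  interpret right_module R M by (fact M)
  note cl = right_submodule_closed[OF M sub]
  have in_M: "x \<in> carrier M" if "x \<in> U" for x using cl(2) that by auto
  define \<psi> where "\<psi> = inv_into U \<phi>"
  have \<psi>: "\<psi> (\<phi> x) = x" if "x \<in> U" for x using inj that by (simp add: \<psi>_def)
  define T :: "('a, 'n) right_mod" where
    "T = \<lparr>carrier = \<phi> ` U, mult = undefined, one = undefined, zero = \<phi> \<zero>\<^bsub>M\<^esub>,
          add = (\<lambda>A B. \<phi> (\<psi> A \<oplus>\<^bsub>M\<^esub> \<psi> B)), ract = (\<lambda>A r. \<phi> (\<psi> A \<triangleleft>\<^bsub>M\<^esub> r))\<rparr>"
  have T: "carrier T = \<phi> ` U" "\<zero>\<^bsub>T\<^esub> = \<phi> \<zero>\<^bsub>M\<^esub>"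
    by (simp_all add: T_def)
  have add_T: "\<phi> x \<oplus>\<^bsub>T\<^esub> \<phi> y = \<phi> (x \<oplus>\<^bsub>M\<^esub> y)" if "x \<in> U" "y \<in> U" for x y
    using that by (simp add: T_def \<psi>)
  have ract_T: "\<phi> x \<triangleleft>\<^bsub>T\<^esub> r = \<phi> (x \<triangleleft>\<^bsub>M\<^esub> r)" if "x \<in> U" for x r
    using that by (simp add: T_def \<psi>)
  have "abelian_group T"
  proof (rule abelian_groupI, goal_cases)
    case (6 x)
    then obtain u where u: "u \<in> U" "x = \<phi> u" by (auto simp: T)
    then have "\<phi> (\<ominus>\<^bsub>M\<^esub> u) \<oplus>\<^bsub>T\<^esub> x = \<zero>\<^bsub>T\<^esub>"
      by (simp add: add_T cl in_M M.l_neg T)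
    then show ?case using u cl by (auto simp: T)
  qed (auto simp: T add_T cl in_M M.a_ac)
  then have rT: "right_module R T"
    using R.ring_axioms
    by (intro right_module.intro right_module_axioms.intro)
      (auto simp: T add_T ract_T cl in_M ract_add_left ract_add_right ract_mult ract_one)
  have "\<exists>n. \<forall>i\<ge>n. C i = C n"
    if C: "\<And>i. right_submodule R (C i) T" "\<And>i. C i \<subseteq> C (Suc i)" for C :: "nat \<Rightarrow> 'n set"
  proof -
    have CU: "C i \<subseteq> \<phi> ` U" for i using right_submodule_closed(2)[OF rT C(1)] by (simp add: T)
    have C_eq: "\<phi> ` \<psi> ` C i = C i" for i
      unfolding image_image \<psi>_def using CU[of i] by (force simp: f_inv_into_f)
    have "right_submodule R (\<psi> ` C i) M" for i
    proof (rule right_submoduleI[OF M])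
      note cli = right_submodule_closed[OF rT C(1)[of i]]
      have mem: "\<exists>u\<in>U. \<phi> u \<in> C i \<and> x = u" if "x \<in> \<psi> ` C i" for x
        using that CU[of i] \<psi> by force
      show "\<zero>\<^bsub>M\<^esub> \<in> \<psi> ` C i" using cli(1) cl(1) \<psi> by (force simp: T)
      show "\<psi> ` C i \<subseteq> carrier M" using mem in_M by blast
      show "x \<oplus>\<^bsub>M\<^esub> y \<in> \<psi> ` C i" if "x \<in> \<psi> ` C i" "y \<in> \<psi> ` C i" for x y
      proof -
        have x: "x \<in> U" "\<phi> x \<in> C i" and y: "y \<in> U" "\<phi> y \<in> C i" using mem that by blast+
        have "\<phi> (x \<oplus>\<^bsub>M\<^esub> y) \<in> C i" using cli(3)[OF x(2) y(2)] x y by (simp add: add_T)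
        then show ?thesis using \<psi>[OF cl(3)[OF x(1) y(1)]] by (metis imageI)
      qed
      show "x \<triangleleft>\<^bsub>M\<^esub> r \<in> \<psi> ` C i" if "x \<in> \<psi> ` C i" "r \<in> carrier R" for x r
      proof -
        have x: "x \<in> U" "\<phi> x \<in> C i" using mem that by blast+
        have "\<phi> (x \<triangleleft>\<^bsub>M\<^esub> r) \<in> C i" using cli(5)[OF x(2) that(2)] x by (simp add: ract_T)
        then show ?thesis using \<psi>[OF cl(5)[OF x(1) that(2)]] by (metis imageI)
      qed
    qed
    moreover have "\<psi> ` C i \<subseteq> \<psi> ` C (Suc i)" for i using C(2) by (rule image_mono)
    ultimately obtain n where "\<forall>i\<ge>n. \<psi> ` C i = \<psi> ` C n"
      using noeth unfolding noetherian_right_module_def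
      by (elim conjE allE[of _ "\<lambda>i. \<psi> ` C i"]) auto
    then show ?thesis using C_eq by metis
  qed
  then have "noetherian_right_module R T"
    using rT by (simp add: noetherian_right_module_def)
  moreover have "annihilator R T (\<phi> x) = annihilator R M x" if "x \<in> U" for x
    using that inj cl by (auto simp: annihilator_def ract_T T inj_on_eq_iff)
  ultimately show thesis using that T by blast
qed

theorem right_noetherian_point_annihilator_setD:
  fixes R :: "('a, 'k) ring_scheme" and M :: "('a, 'm, 'l) right_mod_scheme"
  assumes S: "right_noetherian_point_annihilator_set R S"
    and noeth: "noetherian_right_module R M" and nz: "\<not> zero_module M"
  shows "\<exists>I \<in> point_annihilators R M. I \<in> S"
proof -
  have M: "right_module R M" using noeth by (simp add: noetherian_right_module_def)
  interpret right_module R M by (fact M)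
  obtain m where m: "m \<in> carrier M" "m \<noteq> \<zero>\<^bsub>M\<^esub>"
    using nz M.zero_closed unfolding zero_module_def by blast
  define U where "U = (\<lambda>r. m \<triangleleft>\<^bsub>M\<^esub> r) ` carrier R"
  have "m \<triangleleft>\<^bsub>M\<^esub> \<zero>\<^bsub>R\<^esub> \<oplus>\<^bsub>M\<^esub> m \<triangleleft>\<^bsub>M\<^esub> \<zero>\<^bsub>R\<^esub> = m \<triangleleft>\<^bsub>M\<^esub> \<zero>\<^bsub>R\<^esub>"
    using ract_add_right[OF m(1), of "\<zero>\<^bsub>R\<^esub>" "\<zero>\<^bsub>R\<^esub>"] by simp
  then have "m \<triangleleft>\<^bsub>M\<^esub> \<zero>\<^bsub>R\<^esub> = \<zero>\<^bsub>M\<^esub>"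
    using ract_closed[OF m(1), of "\<zero>\<^bsub>R\<^esub>"] M.add.r_cancel_one by blast
  then have "\<zero>\<^bsub>M\<^esub> \<in> U" unfolding U_def by (metis R.zero_closed imageI)
  then have sub: "right_submodule R U M"
    using m by (intro right_submoduleI[OF M])
      (auto simp: U_def ract_closed ract_add_right[symmetric] ract_mult[symmetric])
  define \<phi> :: "'m \<Rightarrow> (nat \<Rightarrow> 'a) set" where
    "\<phi> x = {f. f 0 \<in> carrier R \<and> m \<triangleleft>\<^bsub>M\<^esub> f 0 = x}" for x
  have inj: "inj_on \<phi> U"
  proof (rule inj_onI)
    fix x y assume "x \<in> U" and eq: "\<phi> x = \<phi> y"
    then obtain r where r: "r \<in> carrier R" "x = m \<triangleleft>\<^bsub>M\<^esub> r" by (auto simp: U_def)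
    then have "(\<lambda>_. r) \<in> \<phi> x" by (simp add: \<phi>_def)
    then have "(\<lambda>_. r) \<in> \<phi> y" using eq by simp
    then show "x = y" using r by (simp add: \<phi>_def)
  qed
  obtain T :: "('a, (nat \<Rightarrow> 'a) set) right_mod"
    where T: "noetherian_right_module R T" "carrier T = \<phi> ` U" "\<zero>\<^bsub>T\<^esub> = \<phi> \<zero>\<^bsub>M\<^esub>"
      "\<And>x. x \<in> U \<Longrightarrow> annihilator R T (\<phi> x) = annihilator R M x"
    using noetherian_copy[OF noeth sub inj, where thesis = thesis] by metis
  have mU: "m \<in> U" using ract_one[OF m(1)] by (force simp: U_def)
  then have "\<phi> m \<noteq> \<phi> \<zero>\<^bsub>M\<^esub>"
    using inj \<open>\<zero>\<^bsub>M\<^esub> \<in> U\<close> m by (auto simp: inj_on_eq_iff)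
  then have "\<not> zero_module T" using T mU by (auto simp: zero_module_def)
  then obtain I where I: "I \<in> point_annihilators R T" "I \<in> S"
    using S T(1) unfolding right_noetherian_point_annihilator_set_def by blast
  then obtain x where x: "x \<in> U" "\<phi> x \<noteq> \<phi> \<zero>\<^bsub>M\<^esub>" "I = annihilator R T (\<phi> x)"
    unfolding point_annihilators_def T(2,3) by blast
  then have "I \<in> point_annihilators R M"
    using T(4) right_submodule_closed(2)[OF M sub] by (auto simp: point_annihilators_def)
  then show ?thesis using I by blast
qed

end

(*
  Let "good" mean that every similar right ideal is principal.  Good right ideals satisfy the Oka
  condition: if I + aR and a^{-1}I are good, then so is I.  If some essential right ideal is not
  principal, Zorn's lemma gives an essential I that is maximal among the right ideals that are not
  good.  Every right ideal strictly above I is then principal, so R/I is noetherian and some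
  a^{-1}I with a not in I lies in S.  It is essential, hence good, and so is I + aR; by the Oka
  condition I is good, a contradiction.  A right ideal that is not essential is a direct summand of an
  essential one.

  For cocritical right ideals, the Krull dimension of a subquotient A/B depends only on the poset of
  submodules between B and A (its deviation), so everything can be done with submodules of a fixed
  module.  In a noetherian module the deviation of A/B exists, because it is bounded by the ordinal
  rank of B under reverse inclusion.  A nonzero submodule of least deviation contains a critical one,
  and the nonzero submodules of a critical module are critical, in particular the cyclic ones.
*)

theory Submission
  imports Defs
begin

section \<open>Epimorphisms from submodules\<close>

text \<open>Principality alone does not pass through the Oka argument: from I + aR = cR one is led
  to c^{-1}I, which in general is only similar to a^{-1}I. Demanding that all similar right ideals
  be principal repairs this, and it is where closure of S under similarity enters. The mechanism is
  that R/I is an extension of R/(I + aR) by (I + aR)/I, and the latter is R/a^{-1}I. Essentiality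
  survives every passage to b^{-1}J, so the test on the essential members of S reaches all right
  ideals similar to the one that was found. For Krull dimension the obstacle is typing: each
  quotient has a new element type, while \<open>krull_class\<close> stays on a single one. Pairs of
  submodules of one fixed module avoid this. The ordinals come from ranks of submodules, realised as
  well-orders on sets of subsets of R, which is the type \<open>'a set set rel\<close> used for
  cocritical right ideals.\<close>

text \<open>
  A module presented as \<open>A/B\<close> for submodules \<open>A\<close>, \<open>B\<close> of a fixed \<open>X\<close>: repeated quotients then do not
  change the element type.
\<close>

definition right_epi ::
    "('a, 'k) ring_scheme \<Rightarrow> ('a, 'x, 'l) right_mod_scheme \<Rightarrow> 'x set \<Rightarrow>
     ('a, 'm, 'n) right_mod_scheme \<Rightarrow> ('x \<Rightarrow> 'm) \<Rightarrow> 'x set \<Rightarrow> bool" where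
  "right_epi R X A M f B \<longleftrightarrow>
     right_module R X \<and> right_submodule R A X \<and> right_module R M \<and> f ` A = carrier M \<and>
     (\<forall>x\<in>A. \<forall>y\<in>A. f (x \<oplus>\<^bsub>X\<^esub> y) = f x \<oplus>\<^bsub>M\<^esub> f y) \<and>
     (\<forall>x\<in>A. \<forall>r\<in>carrier R. f (x \<triangleleft>\<^bsub>X\<^esub> r) = f x \<triangleleft>\<^bsub>M\<^esub> r) \<and>
     B = {x \<in> A. f x = \<zero>\<^bsub>M\<^esub>}"

lemma right_epiI:
  assumes "right_module R X" "right_submodule R A X" "right_module R M" "f ` A = carrier M"
    "\<And>x y. x \<in> A \<Longrightarrow> y \<in> A \<Longrightarrow> f (x \<oplus>\<^bsub>X\<^esub> y) = f x \<oplus>\<^bsub>M\<^esub> f y"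
    "\<And>x r. x \<in> A \<Longrightarrow> r \<in> carrier R \<Longrightarrow> f (x \<triangleleft>\<^bsub>X\<^esub> r) = f x \<triangleleft>\<^bsub>M\<^esub> r"
    "B = {x \<in> A. f x = \<zero>\<^bsub>M\<^esub>}"
  shows "right_epi R X A M f B"
  using assms unfolding right_epi_def by blast

lemma right_epiD:
  assumes "right_epi R X A M f B"
  shows "right_module R X" "right_submodule R A X" "right_module R M" "f ` A = carrier M"
    "\<And>x y. x \<in> A \<Longrightarrow> y \<in> A \<Longrightarrow> f (x \<oplus>\<^bsub>X\<^esub> y) = f x \<oplus>\<^bsub>M\<^esub> f y"
    "\<And>x r. x \<in> A \<Longrightarrow> r \<in> carrier R \<Longrightarrow> f (x \<triangleleft>\<^bsub>X\<^esub> r) = f x \<triangleleft>\<^bsub>M\<^esub> r"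
    "B = {x \<in> A. f x = \<zero>\<^bsub>M\<^esub>}"
    "\<And>x. x \<in> A \<Longrightarrow> f x \<in> carrier M"
  using assms unfolding right_epi_def by blast+

lemma abelian_group_diff_zero:
  assumes "abelian_group G" "x \<in> carrier G"
  shows "x \<ominus>\<^bsub>G\<^esub> \<zero>\<^bsub>G\<^esub> = x"
proof -
  interpret abelian_group G by (fact assms)
  have "\<ominus>\<^bsub>G\<^esub> \<zero>\<^bsub>G\<^esub> = \<zero>\<^bsub>G\<^esub>" by (rule minus_equality) auto
  then show ?thesis using assms by (simp add: a_minus_def)
qed

lemma abelian_group_diff_eq_zero_iff:
  assumes "abelian_group G" "x \<in> carrier G" "y \<in> carrier G"
  shows "x \<ominus>\<^bsub>G\<^esub> y = \<zero>\<^bsub>G\<^esub> \<longleftrightarrow> x = y"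
proof -
  interpret abelian_group G by (fact assms)
  show ?thesis
  proof
    assume "x \<ominus>\<^bsub>G\<^esub> y = \<zero>\<^bsub>G\<^esub>"
    then have "(x \<ominus>\<^bsub>G\<^esub> y) \<oplus>\<^bsub>G\<^esub> y = y" using assms by simp
    then show "x = y" using assms by (simp add: a_minus_def a_assoc l_neg)
  qed (use assms in \<open>simp add: a_minus_def r_neg\<close>)
qed

lemma right_module_carrier_submodule:
  assumes "right_module R M"
  shows "right_submodule R (carrier M) M"
proof -
  interpret right_module R M by (fact assms)
  show ?thesis by (rule right_submoduleI[OF assms]) (auto simp: ract_closed)
qed

lemma right_module_zero_ract:
  assumes "right_module R M" "r \<in> carrier R"
  shows "\<zero>\<^bsub>M\<^esub> \<triangleleft>\<^bsub>M\<^esub> r = \<zero>\<^bsub>M\<^esub>"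
proof -
  interpret right_module R M by (fact assms)
  have "\<zero>\<^bsub>M\<^esub> \<triangleleft>\<^bsub>M\<^esub> r \<oplus>\<^bsub>M\<^esub> \<zero>\<^bsub>M\<^esub> \<triangleleft>\<^bsub>M\<^esub> r = \<zero>\<^bsub>M\<^esub> \<triangleleft>\<^bsub>M\<^esub> r"
    using ract_add_left[of "\<zero>\<^bsub>M\<^esub>" "\<zero>\<^bsub>M\<^esub>" r] assms by simp
  then show ?thesis using ract_closed[of "\<zero>\<^bsub>M\<^esub>" r] M.add.r_cancel_one assms by blast
qed

lemma right_module_restrict:
  assumes "right_module R X" "right_submodule R A X"
  shows "right_module R (X\<lparr>carrier := A\<rparr>)"
proof -
  interpret right_module R X by (fact assms(1))
  note cl = right_submodule_closed[OF assms]
  have in_X: "x \<in> carrier X" if "x \<in> A" for x using cl(2) that by auto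
  have "abelian_group (X\<lparr>carrier := A\<rparr>)"
  proof (rule abelian_groupI, goal_cases)
    case (6 x)
    then show ?case using cl in_X by (auto intro!: bexI[of _ "\<ominus>\<^bsub>X\<^esub> x"] simp: M.l_neg)
  qed (auto simp: cl in_X M.a_ac)
  then show ?thesis
    using R.ring_axioms
    by (intro right_module.intro right_module_axioms.intro)
      (auto simp: cl in_X ract_add_left ract_add_right ract_mult ract_one)
qed

lemma right_submodule_restrict:
  assumes "right_module R X" "right_submodule R A X"
  shows "right_submodule R U (X\<lparr>carrier := A\<rparr>) \<longleftrightarrow> right_submodule R U X \<and> U \<subseteq> A"
proof
  assume U: "right_submodule R U (X\<lparr>carrier := A\<rparr>)"
  note cl = right_submodule_closed[OF right_module_restrict[OF assms] U]
  show "right_submodule R U X \<and> U \<subseteq> A"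
    using cl right_submodule_closed(2)[OF assms] by (auto intro!: right_submoduleI[OF assms(1)])
next
  assume U: "right_submodule R U X \<and> U \<subseteq> A"
  show "right_submodule R U (X\<lparr>carrier := A\<rparr>)"
    using right_submodule_closed[OF assms(1), of U] U
    by (intro right_submoduleI[OF right_module_restrict[OF assms]]) auto
qed

lemma right_epi_zero:
  assumes "right_epi R X A M f B"
  shows "f \<zero>\<^bsub>X\<^esub> = \<zero>\<^bsub>M\<^esub>"
proof -
  note e = right_epiD[OF assms]
  interpret X: right_module R X by (fact e)
  interpret M: right_module R M by (fact e)
  have z: "\<zero>\<^bsub>X\<^esub> \<in> A" using right_submodule_closed(1)[OF e(1,2)] .
  have "f \<zero>\<^bsub>X\<^esub> \<oplus>\<^bsub>M\<^esub> f \<zero>\<^bsub>X\<^esub> = f \<zero>\<^bsub>X\<^esub>" using e(5)[OF z z] by simp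
  then show ?thesis using e(8)[OF z] M.M.add.r_cancel_one by blast
qed

lemma right_epi_minus:
  assumes "right_epi R X A M f B" "x \<in> A" "y \<in> A"
  shows "f (x \<ominus>\<^bsub>X\<^esub> y) = f x \<ominus>\<^bsub>M\<^esub> f y" "x \<ominus>\<^bsub>X\<^esub> y \<in> A"
proof -
  note e = right_epiD[OF assms(1)]
  interpret X: right_module R X by (fact e)
  interpret M: right_module R M by (fact e)
  note cl = right_submodule_closed[OF e(1,2)]
  have in_X: "x \<in> carrier X" if "x \<in> A" for x using cl(2) that by auto
  have "f (\<ominus>\<^bsub>X\<^esub> y) \<oplus>\<^bsub>M\<^esub> f y = \<zero>\<^bsub>M\<^esub>"
    using e(5)[OF cl(4)[OF assms(3)] assms(3)] right_epi_zero[OF assms(1)] in_X[OF assms(3)]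
    by (simp add: X.M.l_neg)
  then have "f (\<ominus>\<^bsub>X\<^esub> y) = \<ominus>\<^bsub>M\<^esub> f y"
    using e(8) cl(4) assms M.M.minus_equality by metis
  then show "f (x \<ominus>\<^bsub>X\<^esub> y) = f x \<ominus>\<^bsub>M\<^esub> f y" "x \<ominus>\<^bsub>X\<^esub> y \<in> A"
    using e(5) cl assms by (simp_all add: a_minus_def)
qed

lemma right_epi_vimage_submodule:
  assumes "right_epi R X A M f B" "right_submodule R N M"
  shows "right_submodule R {x \<in> A. f x \<in> N} X"
proof -
  note e = right_epiD[OF assms(1)]
  note cl = right_submodule_closed[OF e(1,2)] and cN = right_submodule_closed[OF e(3) assms(2)]
  show ?thesis
    by (rule right_submoduleI[OF e(1)])
      (use cl cN e(5,6) right_epi_zero[OF assms(1)] in auto)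
qed

lemma right_epi_kernel_submodule:
  assumes "right_epi R X A M f B"
  shows "right_submodule R B X" "B \<subseteq> A"
proof -
  note e = right_epiD[OF assms]
  interpret M: right_module R M by (fact e)
  have "right_submodule R {\<zero>\<^bsub>M\<^esub>} M"
    by (rule right_submoduleI[OF e(3)]) (auto simp: right_module_zero_ract[OF e(3)])
  from right_epi_vimage_submodule[OF assms this] show "right_submodule R B X" "B \<subseteq> A"
    using e(7) by auto
qed

lemma right_epi_image_submodule:
  assumes "right_epi R X A M f B" "right_submodule R N X" "N \<subseteq> A"
  shows "right_submodule R (f ` N) M"
proof -
  note e = right_epiD[OF assms(1)]
  note cl = right_submodule_closed[OF e(1) assms(2)]
  show ?thesis
  proof (rule right_submoduleI[OF e(3)], goal_cases)
    case 1 then show ?case using cl(1) right_epi_zero[OF assms(1)] by force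
  next
    case 2 then show ?case using e(8) assms(3) by auto
  next
    case (3 x y)
    then obtain u v where "x = f u" "u \<in> N" "y = f v" "v \<in> N" by auto
    then show ?case using e(5)[of u v, symmetric] cl(3) assms(3) by auto
  next
    case (4 x r)
    then obtain u where "x = f u" "u \<in> N" by auto
    then show ?case using e(6)[of u r, symmetric] cl(5) 4 assms(3) by auto
  qed
qed

text \<open>Elements with equal images differ by an element of B, hence of N. Together with
  \<open>right_epi_image_vimage\<close> this is the correspondence between submodules of M and those
  between B and A.\<close>

lemma right_epi_vimage_image:
  assumes "right_epi R X A M f B" "right_submodule R N X" "N \<subseteq> A" "B \<subseteq> N"
  shows "{x \<in> A. f x \<in> f ` N} = N"
proof -
  note e = right_epiD[OF assms(1)]
  interpret X: right_module R X by (fact e)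
  interpret M: right_module R M by (fact e)
  note cl = right_submodule_closed[OF e(1) assms(2)]
  note clA = right_submodule_closed[OF e(1,2)]
  have "x \<in> N" if x: "x \<in> A" "f x \<in> f ` N" for x
  proof -
    obtain u where u: "u \<in> N" "f x = f u" using x by auto
    then have "f (x \<ominus>\<^bsub>X\<^esub> u) = \<zero>\<^bsub>M\<^esub>" "x \<ominus>\<^bsub>X\<^esub> u \<in> A"
      using right_epi_minus[OF assms(1) x(1), of u] assms(3) e(8) by (auto simp: M.M.r_neg a_minus_def)
    then have "x \<ominus>\<^bsub>X\<^esub> u \<in> N" using e(7) assms(4) by auto
    then have "(x \<ominus>\<^bsub>X\<^esub> u) \<oplus>\<^bsub>X\<^esub> u \<in> N" using cl(3) u by auto
    moreover have "(x \<ominus>\<^bsub>X\<^esub> u) \<oplus>\<^bsub>X\<^esub> u = x"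
      using clA(2) x u cl(2) by (auto simp: a_minus_def X.M.a_assoc X.M.l_neg subset_iff)
    ultimately show ?thesis by simp
  qed
  then show ?thesis using assms(3) by blast
qed

lemma right_epi_image_vimage:
  assumes "right_epi R X A M f B" "right_submodule R N M"
  shows "f ` {x \<in> A. f x \<in> N} = N"
proof -
  have "N \<subseteq> f ` A"
    using right_submodule_closed(2)[OF right_epiD(3)[OF assms(1)] assms(2)]
    by (simp add: right_epiD(4)[OF assms(1)])
  then show ?thesis by blast
qed

text \<open>Because \<open>g\<close> is defined only on the submodule N of M, the domain shrinks to
  its preimage. This presents a subquotient N/K of M as a subquotient of X without changing the
  element type of the presentation.\<close>

lemma right_epi_comp:
  assumes "right_epi R X A M f B" "right_epi R M N Q g K"
  shows "right_epi R X {x \<in> A. f x \<in> N} Q (g \<circ> f) {x \<in> A. f x \<in> K}"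
proof -
  note e = right_epiD[OF assms(1)] and h = right_epiD[OF assms(2)]
  show ?thesis
  proof (rule right_epiI[OF e(1) _ h(3)])
    show "right_submodule R {x \<in> A. f x \<in> N} X"
      by (rule right_epi_vimage_submodule[OF assms(1) h(2)])
    show "(g \<circ> f) ` {x \<in> A. f x \<in> N} = carrier Q"
      using right_epi_image_vimage[OF assms(1) h(2)] h(4) by (simp only: image_comp[symmetric])
  qed (use e h in auto)
qed

text \<open>Both modules are A/B: \<open>f\<close> and \<open>g\<close> identify exactly the pairs
  whose difference lies in B.\<close>

lemma right_epi_iso:
  assumes "right_epi R X A M f B" "right_epi R X A Q g B"
  shows "right_module_isomorphic R M Q"
proof -
  note e = right_epiD[OF assms(1)] and h = right_epiD[OF assms(2)]
  interpret X: right_module R X by (fact e)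
  interpret M: right_module R M by (fact e)
  interpret Q: right_module R Q by (fact h)
  note cl = right_submodule_closed[OF e(1,2)]
  have iff: "f x = f y \<longleftrightarrow> g x = g y" if "x \<in> A" "y \<in> A" for x y
  proof -
    have "f x = f y \<longleftrightarrow> x \<ominus>\<^bsub>X\<^esub> y \<in> B"
      using right_epi_minus[OF assms(1) that] e(7,8) that by (auto simp: abelian_group_diff_eq_zero_iff[OF M.M.abelian_group_axioms])
    also have "\<dots> \<longleftrightarrow> g x = g y"
      using right_epi_minus[OF assms(2) that] h(7,8) that by (auto simp: abelian_group_diff_eq_zero_iff[OF Q.M.abelian_group_axioms])
    finally show ?thesis .
  qed
  \<comment> \<open>The induced map sends m to the \<open>g\<close>-value of a chosen
    \<open>f\<close>-preimage; \<open>iff\<close> makes the choice irrelevant.\<close>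
  define k where "k m = g (SOME x. x \<in> A \<and> f x = m)" for m
  have k: "k (f x) = g x" if "x \<in> A" for x
  proof -
    have "(SOME y. y \<in> A \<and> f y = f x) \<in> A \<and> f (SOME y. y \<in> A \<and> f y = f x) = f x"
      by (rule someI[of _ x]) (use that in simp)
    then show ?thesis unfolding k_def using iff that by blast
  qed
  have "inj_on k (carrier M)"
    unfolding e(4)[symmetric] by (rule inj_onI) (auto simp: k iff)
  moreover have "k ` carrier M = carrier Q"
    unfolding e(4)[symmetric] h(4)[symmetric] by (auto simp: k image_image)
  moreover have "k (x \<oplus>\<^bsub>M\<^esub> y) = k x \<oplus>\<^bsub>Q\<^esub> k y" if xy: "x \<in> carrier M" "y \<in> carrier M" for x y
  proof -
    obtain u v where "u \<in> A" "v \<in> A" "x = f u" "y = f v" using xy unfolding e(4)[symmetric] by blast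
    then show ?thesis using e(5)[of u v, symmetric] h(5) cl(3) by (simp add: k)
  qed
  moreover have "k (x \<triangleleft>\<^bsub>M\<^esub> r) = k x \<triangleleft>\<^bsub>Q\<^esub> r" if x: "x \<in> carrier M" "r \<in> carrier R" for x r
  proof -
    obtain u where "u \<in> A" "x = f u" using x unfolding e(4)[symmetric] by blast
    then show ?thesis using e(6)[of u r, symmetric] h(6) cl(5) x by (simp add: k)
  qed
  ultimately show ?thesis
    unfolding right_module_isomorphic_def
    by (intro bexI[of _ k]) (auto simp: iso_def hom_def bij_betw_def)
qed

section \<open>Isomorphic modules and their presentations\<close>

lemma right_module_isomorphic_epi:
  assumes "right_module R M" "right_module R Q" "right_module_isomorphic R M Q"
  obtains g where "right_epi R M (carrier M) Q g {\<zero>\<^bsub>M\<^esub>}"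
proof -
  interpret M: right_module R M by (fact assms)
  interpret Q: right_module R Q by (fact assms)
  obtain g where g: "g \<in> iso (add_monoid M) (add_monoid Q)"
    "\<forall>x\<in>carrier M. \<forall>r\<in>carrier R. g (x \<triangleleft>\<^bsub>M\<^esub> r) = g x \<triangleleft>\<^bsub>Q\<^esub> r"
    using assms(3) unfolding right_module_isomorphic_def by blast
  have 1: "bij_betw g (carrier M) (carrier Q)"
    "\<And>x y. x \<in> carrier M \<Longrightarrow> y \<in> carrier M \<Longrightarrow> g (x \<oplus>\<^bsub>M\<^esub> y) = g x \<oplus>\<^bsub>Q\<^esub> g y"
    using g(1) by (auto simp: iso_def hom_def)
  have "right_epi R M (carrier M) Q g {x \<in> carrier M. g x = \<zero>\<^bsub>Q\<^esub>}"
    by (rule right_epiI[OF assms(1) right_module_carrier_submodule[OF assms(1)] assms(2)])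
      (use 1(2) g(2) bij_betw_imp_surj_on[OF 1(1)] in simp_all)
  moreover from right_epi_zero[OF this] have "{x \<in> carrier M. g x = \<zero>\<^bsub>Q\<^esub>} = {\<zero>\<^bsub>M\<^esub>}"
    using inj_onD[OF bij_betw_imp_inj_on[OF 1(1)]] by auto
  ultimately show ?thesis using that by simp
qed

text \<open>M presents both Q (by the isomorphism) and M itself (by the identity) with zero kernel,
  so the common-kernel lemma may be applied in the reverse order.\<close>

lemma right_module_isomorphic_sym:
  assumes "right_module R M" "right_module R Q" "right_module_isomorphic R M Q"
  shows "right_module_isomorphic R Q M"
proof -
  obtain g where g: "right_epi R M (carrier M) Q g {\<zero>\<^bsub>M\<^esub>}"
    using right_module_isomorphic_epi[OF assms] .
  have "right_epi R M (carrier M) M (\<lambda>x. x) {\<zero>\<^bsub>M\<^esub>}"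
    by (rule right_epiI[OF assms(1) right_module_carrier_submodule[OF assms(1)] assms(1)])
      (use right_submodule_closed(1)[OF assms(1) right_module_carrier_submodule[OF assms(1)]] in auto)
  then show ?thesis using right_epi_iso[OF g] by blast
qed

lemma right_epi_isomorphic:
  assumes "right_epi R X A M f B" "right_module R Q" "right_module_isomorphic R M Q"
  obtains g where "right_epi R X A Q g B"
proof -
  note e = right_epiD[OF assms(1)]
  obtain g where g: "right_epi R M (carrier M) Q g {\<zero>\<^bsub>M\<^esub>}"
    using right_module_isomorphic_epi[OF e(3) assms(2,3)] .
  have "{x \<in> A. f x \<in> carrier M} = A" "{x \<in> A. f x \<in> {\<zero>\<^bsub>M\<^esub>}} = B" using e(7,8) by auto
  with right_epi_comp[OF assms(1) g] that[of "g \<circ> f"] show ?thesis by simp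
qed

text \<open>Transport of structure, needed because \<open>krull_class\<close> asks for chain factors
  over the element type of M, whereas the elements of a quotient are cosets.\<close>

lemma right_module_copy:
  fixes M :: "('a, 'm, 'l) right_mod_scheme" and \<phi> :: "'m \<Rightarrow> 'n"
  assumes M: "right_module R M" and inj: "inj_on \<phi> (carrier M)"
  obtains T :: "('a, 'n) right_mod"
  where "right_epi R M (carrier M) T \<phi> {\<zero>\<^bsub>M\<^esub>}"
proof -
  interpret right_module R M by (fact M)
  define \<psi> where "\<psi> = inv_into (carrier M) \<phi>"
  have \<psi>: "\<psi> (\<phi> x) = x" if "x \<in> carrier M" for x using inj that by (simp add: \<psi>_def)
  define T :: "('a, 'n) right_mod" where
    "T = \<lparr>carrier = \<phi> ` carrier M, mult = undefined, one = undefined, zero = \<phi> \<zero>\<^bsub>M\<^esub>,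
          add = (\<lambda>A B. \<phi> (\<psi> A \<oplus>\<^bsub>M\<^esub> \<psi> B)), ract = (\<lambda>A r. \<phi> (\<psi> A \<triangleleft>\<^bsub>M\<^esub> r))\<rparr>"
  have T: "carrier T = \<phi> ` carrier M" "\<zero>\<^bsub>T\<^esub> = \<phi> \<zero>\<^bsub>M\<^esub>"
    by (simp_all add: T_def)
  have add_T: "\<phi> x \<oplus>\<^bsub>T\<^esub> \<phi> y = \<phi> (x \<oplus>\<^bsub>M\<^esub> y)" if "x \<in> carrier M" "y \<in> carrier M" for x y
    using that by (simp add: T_def \<psi>)
  have ract_T: "\<phi> x \<triangleleft>\<^bsub>T\<^esub> r = \<phi> (x \<triangleleft>\<^bsub>M\<^esub> r)" if "x \<in> carrier M" for x r
    using that by (simp add: T_def \<psi>)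
  have "abelian_group T"
  proof (rule abelian_groupI, goal_cases)
    case (6 x)
    then obtain u where u: "u \<in> carrier M" "x = \<phi> u" by (auto simp: T)
    then have "\<phi> (\<ominus>\<^bsub>M\<^esub> u) \<oplus>\<^bsub>T\<^esub> x = \<zero>\<^bsub>T\<^esub>" by (simp add: add_T M.l_neg T)
    then show ?case using u by (auto simp: T)
  qed (auto simp: T add_T M.a_ac)
  then have rT: "right_module R T"
    using R.ring_axioms
    by (intro right_module.intro right_module_axioms.intro)
      (auto simp: T add_T ract_T ract_closed ract_add_left ract_add_right ract_mult ract_one)
  have "right_epi R M (carrier M) T \<phi> {\<zero>\<^bsub>M\<^esub>}"
    by (rule right_epiI[OF M right_module_carrier_submodule[OF M] rT])
      (use inj in \<open>auto simp: T add_T ract_T inj_on_def\<close>)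
  then show ?thesis using that by blast
qed

section \<open>Quotients of submodules\<close>

lemma a_r_coset_eq_iff:
  assumes "right_module R X" "right_submodule R B X" "x \<in> carrier X" "y \<in> carrier X"
  shows "B +>\<^bsub>X\<^esub> x = B +>\<^bsub>X\<^esub> y \<longleftrightarrow> x \<ominus>\<^bsub>X\<^esub> y \<in> B"
proof -
  interpret right_module R X by (fact assms)
  have "abelian_subgroup B X"
    using assms(2) by (intro abelian_subgroupI3 additive_subgroup.intro)
      (auto simp: right_submodule_def M.abelian_group_axioms)
  then interpret B: abelian_subgroup B X .
  show ?thesis
    using B.a_rcos_module[OF assms(4,3)] B.a_repr_independence'[OF _ assms(4), of x] 
      B.a_rcos_self[OF assms(3)] by (auto simp: a_minus_def)
qed

lemma right_epi_quotient:
  assumes X: "right_module R X" and A: "right_submodule R A X" and B: "right_submodule R B X"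
    and BA: "B \<subseteq> A"
  shows "right_epi R X A (quotient_module (X\<lparr>carrier := A\<rparr>) B) (\<lambda>x. B +>\<^bsub>X\<^esub> x) B"
proof -
  interpret right_module R X by (fact X)
  define Q where "Q = quotient_module (X\<lparr>carrier := A\<rparr>) B"
  note cl = right_submodule_closed[OF X A] and cB = right_submodule_closed[OF X B]
  have in_X: "x \<in> carrier X" if "x \<in> A" for x using cl(2) that by auto
  have "abelian_subgroup B X"
    using B by (intro abelian_subgroupI3 additive_subgroup.intro)
      (auto simp: right_submodule_def M.abelian_group_axioms)
  then interpret B: abelian_subgroup B X .
  note eq = a_r_coset_eq_iff[OF X B]
  have cQ: "carrier Q = (\<lambda>x. B +>\<^bsub>X\<^esub> x) ` A"
    by (auto simp: Q_def quotient_module_def A_RCOSETS_def' a_r_coset_def')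
  have aQ: "(B +>\<^bsub>X\<^esub> x) \<oplus>\<^bsub>Q\<^esub> (B +>\<^bsub>X\<^esub> y) = B +>\<^bsub>X\<^esub> (x \<oplus>\<^bsub>X\<^esub> y)" if "x \<in> A" "y \<in> A" for x y
  proof -
    have "(B +>\<^bsub>X\<^esub> x) \<oplus>\<^bsub>Q\<^esub> (B +>\<^bsub>X\<^esub> y) = (B +>\<^bsub>X\<^esub> x) <+>\<^bsub>X\<^esub> (B +>\<^bsub>X\<^esub> y)"
      by (simp add: Q_def quotient_module_def set_add_def set_mult_def)
    then show ?thesis using B.a_rcos_sum that in_X by simp
  qed
  have zQ: "\<zero>\<^bsub>Q\<^esub> = B +>\<^bsub>X\<^esub> \<zero>\<^bsub>X\<^esub>"
    using M.a_coset_add_zero[OF B.a_subset] by (simp add: Q_def quotient_module_def)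
  have rQ: "(B +>\<^bsub>X\<^esub> x) \<triangleleft>\<^bsub>Q\<^esub> r = B +>\<^bsub>X\<^esub> (x \<triangleleft>\<^bsub>X\<^esub> r)" if x: "x \<in> A" "r \<in> carrier R" for x r
  proof -
    have 1: "(B +>\<^bsub>X\<^esub> x) \<triangleleft>\<^bsub>Q\<^esub> r = (\<Union>y\<in>B +>\<^bsub>X\<^esub> x. B +>\<^bsub>X\<^esub> (y \<triangleleft>\<^bsub>X\<^esub> r))"
      by (simp add: Q_def quotient_module_def a_r_coset_def')
    \<comment> \<open>The action on a coset is a union over all its representatives. All members of
      the union coincide, since representatives differ by some b in B and b r stays in B; the coset
      being nonempty, the union is that common value.\<close>
    have "B +>\<^bsub>X\<^esub> (y \<triangleleft>\<^bsub>X\<^esub> r) = B +>\<^bsub>X\<^esub> (x \<triangleleft>\<^bsub>X\<^esub> r)" if y: "y \<in> B +>\<^bsub>X\<^esub> x" for y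
    proof -
      obtain b where b: "b \<in> B" "y = b \<oplus>\<^bsub>X\<^esub> x" using y by (auto simp: a_r_coset_def')
      then have "y \<triangleleft>\<^bsub>X\<^esub> r \<ominus>\<^bsub>X\<^esub> x \<triangleleft>\<^bsub>X\<^esub> r = b \<triangleleft>\<^bsub>X\<^esub> r"
        using x in_X cB(2) by (auto simp: ract_add_left ract_closed a_minus_def M.a_assoc M.r_neg subset_iff)
      then show ?thesis
        using eq[of "y \<triangleleft>\<^bsub>X\<^esub> r" "x \<triangleleft>\<^bsub>X\<^esub> r"] b x cB(2,5) in_X by (auto simp: ract_closed subset_iff)
    qed
    moreover have "B +>\<^bsub>X\<^esub> x \<noteq> {}" using B.a_rcos_self in_X x by blast
    ultimately show ?thesis unfolding 1 by blast
  qed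
  have "abelian_group Q"
  proof (rule abelian_groupI, goal_cases)
    case (6 x)
    then obtain u where u: "u \<in> A" "x = B +>\<^bsub>X\<^esub> u" by (auto simp: cQ)
    then have "(B +>\<^bsub>X\<^esub> (\<ominus>\<^bsub>X\<^esub> u)) \<oplus>\<^bsub>Q\<^esub> x = \<zero>\<^bsub>Q\<^esub>" by (simp add: aQ M.l_neg zQ cl in_X)
    then show ?case using u cl by (auto simp: cQ)
  qed (auto simp: cQ aQ zQ M.a_ac cl in_X)
  then have "right_module R Q"
    using R.ring_axioms
    by (intro right_module.intro right_module_axioms.intro)
      (auto simp: cQ aQ rQ cl in_X ract_closed ract_add_left ract_add_right ract_mult ract_one)
  then have "right_epi R X A Q (\<lambda>x. B +>\<^bsub>X\<^esub> x) B"
  proof (rule right_epiI[OF X A])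
    have "B +>\<^bsub>X\<^esub> x = \<zero>\<^bsub>Q\<^esub> \<longleftrightarrow> x \<in> B" if "x \<in> A" for x
      unfolding zQ using eq[of x "\<zero>\<^bsub>X\<^esub>"] in_X[OF that] by (simp add: abelian_group_diff_zero[OF M.abelian_group_axioms])
    then show "B = {x \<in> A. B +>\<^bsub>X\<^esub> x = \<zero>\<^bsub>Q\<^esub>}" using BA by blast
  qed (auto simp: cQ aQ rQ)
  then show ?thesis by (simp add: Q_def)
qed

lemma right_epi_quotient_full:
  assumes "right_module R X" "right_submodule R B X"
  shows "right_epi R X (carrier X) (quotient_module X B) (\<lambda>x. B +>\<^bsub>X\<^esub> x) B"
  using right_epi_quotient[OF assms(1) right_module_carrier_submodule[OF assms(1)] assms(2)]
    right_submodule_closed(2)[OF assms] by simp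

section \<open>Right ideals and the Oka condition\<close>

lemma right_module_regular:
  assumes "ring R"
  shows "right_module R (regular_module R)"
proof -
  interpret ring R by (fact assms)
  have "abelian_group (regular_module R)"
  proof (rule abelian_groupI, goal_cases)
    case (6 x)
    then show ?case by (auto simp: regular_module_def l_neg intro!: bexI[of _ "\<ominus>\<^bsub>R\<^esub> x"])
  qed (auto simp: regular_module_def a_ac)
  then show ?thesis
    using ring_axioms
    by (intro right_module.intro right_module_axioms.intro)
      (auto simp: regular_module_def l_distr r_distr m_assoc)
qed

lemma regular_module_simps [simp]:
  "carrier (regular_module R) = carrier R"
  "\<zero>\<^bsub>regular_module R\<^esub> = \<zero>\<^bsub>R\<^esub>"
  "x \<oplus>\<^bsub>regular_module R\<^esub> y = x \<oplus>\<^bsub>R\<^esub> y"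
  "x \<triangleleft>\<^bsub>regular_module R\<^esub> y = x \<otimes>\<^bsub>R\<^esub> y"
  by (simp_all add: regular_module_def)

text \<open>Usually written a^{-1}I: the annihilator of the coset of a in R/I, so that R/a^{-1}I is
  the cyclic module (I + aR)/I.\<close>

definition right_colon :: "('a, 'k) ring_scheme \<Rightarrow> 'a \<Rightarrow> 'a set \<Rightarrow> 'a set" where
  "right_colon R a I = {r \<in> carrier R. a \<otimes>\<^bsub>R\<^esub> r \<in> I}"

definition right_multiples :: "('a, 'k) ring_scheme \<Rightarrow> 'a \<Rightarrow> 'a set" where
  "right_multiples R a = (\<lambda>r. a \<otimes>\<^bsub>R\<^esub> r) ` carrier R"

text \<open>
  The right ideals similar to \<open>I\<close> are the \<open>a\<^sup>-\<^sup>1I\<close> with \<open>I + aR = R\<close>.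
\<close>

definition principal_up_to_similarity :: "('a, 'k) ring_scheme \<Rightarrow> 'a set \<Rightarrow> bool" where
  "principal_up_to_similarity R I \<longleftrightarrow>
     (\<forall>a\<in>carrier R. \<one>\<^bsub>R\<^esub> \<in> I <+>\<^bsub>R\<^esub> right_multiples R a \<longrightarrow> principal_right_ideal (right_colon R a I) R)"

section \<open>Arithmetic of right ideals and colons\<close>

context ring
begin

lemma right_idealI:
  assumes "\<zero> \<in> I" "I \<subseteq> carrier R" "\<And>x y. x \<in> I \<Longrightarrow> y \<in> I \<Longrightarrow> x \<oplus> y \<in> I"
    "\<And>x r. x \<in> I \<Longrightarrow> r \<in> carrier R \<Longrightarrow> x \<otimes> r \<in> I"
  shows "right_ideal I R"
  unfolding right_ideal_def
  by (rule right_submoduleI[OF right_module_regular[OF ring_axioms]]) (use assms in auto)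

lemma right_idealD:
  assumes "right_ideal I R"
  shows "\<zero> \<in> I" "I \<subseteq> carrier R" "\<And>x y. x \<in> I \<Longrightarrow> y \<in> I \<Longrightarrow> x \<oplus> y \<in> I"
    "\<And>x r. x \<in> I \<Longrightarrow> r \<in> carrier R \<Longrightarrow> x \<otimes> r \<in> I"
    "\<And>x. x \<in> I \<Longrightarrow> x \<in> carrier R"
    "\<And>x. x \<in> I \<Longrightarrow> \<ominus> x \<in> I"
    "\<And>x y. x \<in> I \<Longrightarrow> y \<in> I \<Longrightarrow> x \<ominus> y \<in> I"
proof -
  note cl = right_submodule_closed[OF right_module_regular[OF ring_axioms]
      assms[unfolded right_ideal_def], simplified]
  show 0: "\<zero> \<in> I" "I \<subseteq> carrier R" "\<And>x y. x \<in> I \<Longrightarrow> y \<in> I \<Longrightarrow> x \<oplus> y \<in> I"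
    "\<And>x r. x \<in> I \<Longrightarrow> r \<in> carrier R \<Longrightarrow> x \<otimes> r \<in> I"
    using cl by auto
  then show 1: "\<And>x. x \<in> I \<Longrightarrow> x \<in> carrier R" by auto
  show 2: "\<ominus> x \<in> I" if "x \<in> I" for x
    using 0(4)[OF that, of "\<ominus> \<one>"] 1[OF that] by (simp add: r_minus)
  show "\<And>x y. x \<in> I \<Longrightarrow> y \<in> I \<Longrightarrow> x \<ominus> y \<in> I" using 0 2 by (simp add: a_minus_def)
qed

lemma right_ideal_one:
  assumes "right_ideal I R" "\<one> \<in> I"
  shows "I = carrier R"
  using right_idealD(2)[OF assms(1)] right_idealD(4)[OF assms] by force

lemma right_ideal_carrier: "right_ideal (carrier R) R"
  by (rule right_idealI) auto

lemma right_ideal_multiples: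
  assumes "a \<in> carrier R"
  shows "right_ideal (right_multiples R a) R"
proof (rule right_idealI)
  show "\<zero> \<in> right_multiples R a" using assms unfolding right_multiples_def by (auto intro!: image_eqI[of _ _ \<zero>])
qed (use assms in \<open>auto simp: right_multiples_def r_distr[symmetric] m_assoc\<close>)

lemma mem_multiples_self: "a \<in> carrier R \<Longrightarrow> a \<in> right_multiples R a"
  unfolding right_multiples_def by (auto intro!: image_eqI[of _ _ \<one>])

lemma right_multiples_subset:
  assumes "right_ideal I R" "a \<in> I"
  shows "right_multiples R a \<subseteq> I"
  using right_idealD(4)[OF assms] by (auto simp: right_multiples_def)

lemma principal_right_ideal_iff:
  "principal_right_ideal I R \<longleftrightarrow> (\<exists>x\<in>carrier R. I = right_multiples R x)"
  by (simp add: principal_right_ideal_def right_multiples_def)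

lemma right_ideal_sum:
  assumes "right_ideal I R" "right_ideal J R"
  shows "right_ideal (I <+>\<^bsub>R\<^esub> J) R" "I \<subseteq> I <+>\<^bsub>R\<^esub> J" "J \<subseteq> I <+>\<^bsub>R\<^esub> J"
proof -
  note i = right_idealD[OF assms(1)] and j = right_idealD[OF assms(2)]
  have mem: "x \<in> I <+>\<^bsub>R\<^esub> J \<longleftrightarrow> (\<exists>u\<in>I. \<exists>v\<in>J. x = u \<oplus> v)" for x by (auto simp: set_add_def')
  show "right_ideal (I <+>\<^bsub>R\<^esub> J) R"
  proof (rule right_idealI)
    show "\<zero> \<in> I <+>\<^bsub>R\<^esub> J" unfolding mem using i(1) j(1) by (auto intro!: bexI[of _ \<zero>])
    show "I <+>\<^bsub>R\<^esub> J \<subseteq> carrier R" using i(5) j(5) by (auto simp: mem)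
    show "x \<oplus> y \<in> I <+>\<^bsub>R\<^esub> J" if xy: "x \<in> I <+>\<^bsub>R\<^esub> J" "y \<in> I <+>\<^bsub>R\<^esub> J" for x y
    proof -
      obtain u v u' v' where "u \<in> I" "v \<in> J" "x = u \<oplus> v" "u' \<in> I" "v' \<in> J" "y = u' \<oplus> v'"
        using xy unfolding mem by blast
      moreover from this have "x \<oplus> y = (u \<oplus> u') \<oplus> (v \<oplus> v')" using i(5) j(5) by (simp add: a_ac)
      ultimately show ?thesis unfolding mem using i(3) j(3) by blast
    qed
    show "x \<otimes> r \<in> I <+>\<^bsub>R\<^esub> J" if x: "x \<in> I <+>\<^bsub>R\<^esub> J" and r: "r \<in> carrier R" for x r
    proof -
      obtain u v where u: "u \<in> I" "v \<in> J" "x = u \<oplus> v" using x unfolding mem by blast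
      then have "x \<otimes> r = u \<otimes> r \<oplus> v \<otimes> r" using i(5) j(5) r by (simp add: l_distr)
      then show ?thesis unfolding mem using i(4) j(4) u r by blast
    qed
  qed
  show "I \<subseteq> I <+>\<^bsub>R\<^esub> J"
    unfolding subset_iff mem using i(5) j(1) r_zero by metis
  show "J \<subseteq> I <+>\<^bsub>R\<^esub> J"
    unfolding subset_iff mem using i(1) j(5) l_zero by metis
qed

lemma right_ideal_sum_subset:
  assumes "right_ideal K R" "I \<subseteq> K" "J \<subseteq> K"
  shows "I <+>\<^bsub>R\<^esub> J \<subseteq> K"
  using right_idealD(3)[OF assms(1)] assms(2,3) by (auto simp: set_add_def')

lemma mem_sum_multiples:
  "x \<in> I <+>\<^bsub>R\<^esub> right_multiples R a \<longleftrightarrow> (\<exists>i\<in>I. \<exists>r\<in>carrier R. x = i \<oplus> a \<otimes> r)"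
  by (auto simp: set_add_def' right_multiples_def)

lemma right_ideal_colon:
  assumes "right_ideal I R" "a \<in> carrier R"
  shows "right_ideal (right_colon R a I) R"
  by (rule right_idealI)
    (use right_idealD[OF assms(1)] assms(2) in \<open>auto simp: right_colon_def r_distr m_assoc[symmetric]\<close>)

lemma right_colon_colon:
  assumes "a \<in> carrier R" "b \<in> carrier R"
  shows "right_colon R b (right_colon R a I) = right_colon R (a \<otimes> b) I"
  using assms by (auto simp: right_colon_def m_assoc)

text \<open>The annihilator of a coset does not depend on its representative.\<close>

lemma right_colon_eqI:
  assumes "right_ideal I R" "a \<in> carrier R" "b \<in> carrier R" "a \<ominus> b \<in> I"
  shows "right_colon R a I = right_colon R b I"
proof -
  note i = right_idealD[OF assms(1)]
  have eq: "a \<otimes> r = (a \<ominus> b) \<otimes> r \<oplus> b \<otimes> r" "b \<otimes> r = a \<otimes> r \<ominus> (a \<ominus> b) \<otimes> r" if "r \<in> carrier R" for r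
    using that assms(2,3) by algebra+
  show ?thesis
    unfolding right_colon_def
    using eq i(3,7) i(4)[OF assms(4)] by (metis (lifting))
qed

text \<open>The case a = 1, because 1^{-1}I = I.\<close>

lemma principal_up_to_similarity_principal:
  assumes "right_ideal I R" "principal_up_to_similarity R I"
  shows "principal_right_ideal I R"
proof -
  have "\<one> \<in> I <+>\<^bsub>R\<^esub> right_multiples R \<one>"
    using right_ideal_sum(3)[OF assms(1) right_ideal_multiples] mem_multiples_self by blast
  then have "principal_right_ideal (right_colon R \<one> I) R"
    using assms(2) unfolding principal_up_to_similarity_def by blast
  moreover have "right_colon R \<one> I = I" using right_idealD[OF assms(1)] by (auto simp: right_colon_def)
  ultimately show ?thesis by simp
qed

text \<open>Let J = b^{-1}I be any right ideal similar to I. The element a is carried over to some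
  a' along R/J = R/I, so that J + a'R is similar to I + aR and a'^{-1}J equals a^{-1}I. The first is
  then some cR, and c^{-1}J, being similar to the second, is some kR. Hence J = ckR.\<close>

lemma principal_up_to_similarity_Oka:
  assumes I: "right_ideal I R" and a: "a \<in> carrier R"
    and sum: "principal_up_to_similarity R (I <+>\<^bsub>R\<^esub> right_multiples R a)"
    and col: "principal_up_to_similarity R (right_colon R a I)"
  shows "principal_up_to_similarity R I"
  unfolding principal_up_to_similarity_def
proof (intro ballI impI)
  fix b assume b: "b \<in> carrier R" and one: "\<one> \<in> I <+>\<^bsub>R\<^esub> right_multiples R b"
  note i = right_idealD[OF I]
  define J where "J = right_colon R b I"
  have J: "right_ideal J R" unfolding J_def by (rule right_ideal_colon[OF I b])
  note j = right_idealD[OF J]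
  let ?Ia = "I <+>\<^bsub>R\<^esub> right_multiples R a"
  note Ia = right_ideal_sum[OF I right_ideal_multiples[OF a]]
  obtain i0 s where s: "i0 \<in> I" "s \<in> carrier R" "\<one> = i0 \<oplus> b \<otimes> s"
    using one unfolding mem_sum_multiples by blast
  \<comment> \<open>Left multiplication by b induces the isomorphism from R/J to R/I. It sends s to
    1 modulo I, hence s a to a.\<close>
  define a' where "a' = s \<otimes> a"
  have a': "a' \<in> carrier R" using s a by (simp add: a'_def)
  have "a = (i0 \<oplus> b \<otimes> s) \<otimes> a" using a by (simp flip: s(3))
  also have "\<dots> = i0 \<otimes> a \<oplus> b \<otimes> a'" using i(5) s a b by (simp add: a'_def l_distr m_assoc)
  finally have aa': "a = i0 \<otimes> a \<oplus> b \<otimes> a'" .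
  have "a \<ominus> b \<otimes> a' = (i0 \<otimes> a \<oplus> b \<otimes> a') \<ominus> b \<otimes> a'" using aa' by simp
  also have "\<dots> = i0 \<otimes> a" using i(5) s(1) a a' b by algebra
  finally have diff: "a \<ominus> b \<otimes> a' \<in> I" using i(4) s(1) a by simp
  have colJ: "right_colon R a' J = right_colon R a I"
    unfolding J_def right_colon_colon[OF b a']
    by (rule right_colon_eqI[symmetric]) (use I a a' b diff in auto)
  \<comment> \<open>This exhibits J + a'R as b^{-1}(I + aR). As 1 lies in I + bR, it lies in I + aR
    + bR, so goodness of I + aR applies to it.\<close>
  have sumJ: "J <+>\<^bsub>R\<^esub> right_multiples R a' = right_colon R b ?Ia"
  proof
    show "J <+>\<^bsub>R\<^esub> right_multiples R a' \<subseteq> right_colon R b ?Ia"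
    proof
      fix x assume "x \<in> J <+>\<^bsub>R\<^esub> right_multiples R a'"
      then obtain y r where y: "y \<in> J" "r \<in> carrier R" "x = y \<oplus> a' \<otimes> r"
        unfolding mem_sum_multiples by blast
      have "b \<otimes> x = (b \<otimes> y \<ominus> (a \<ominus> b \<otimes> a') \<otimes> r) \<oplus> a \<otimes> r"
        unfolding y(3) using j(5)[OF y(1)] y(2) a a' b by algebra
      moreover have "b \<otimes> y \<ominus> (a \<ominus> b \<otimes> a') \<otimes> r \<in> I"
        using y i(4,7) diff by (auto simp: J_def right_colon_def)
      ultimately have "b \<otimes> x \<in> ?Ia" unfolding mem_sum_multiples using y(2) by blast
      then show "x \<in> right_colon R b ?Ia" using y a' j(5) by (simp add: right_colon_def)
    qed
    show "right_colon R b ?Ia \<subseteq> J <+>\<^bsub>R\<^esub> right_multiples R a'"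
    proof
      fix x assume "x \<in> right_colon R b ?Ia"
      then obtain y r where y: "x \<in> carrier R" "y \<in> I" "r \<in> carrier R" "b \<otimes> x = y \<oplus> a \<otimes> r"
        unfolding right_colon_def mem_sum_multiples by blast
      have "b \<otimes> (x \<ominus> a' \<otimes> r) = b \<otimes> x \<ominus> b \<otimes> a' \<otimes> r"
        using y(1,3) a' b by algebra
      also have "\<dots> = y \<oplus> (a \<ominus> b \<otimes> a') \<otimes> r"
        unfolding y(4) using i(5)[OF y(2)] y(3) a a' b by algebra
      finally have "b \<otimes> (x \<ominus> a' \<otimes> r) \<in> I" using i(3,4) y diff by simp
      then have "x \<ominus> a' \<otimes> r \<in> J" using y a' by (simp add: J_def right_colon_def)
      moreover have "x = (x \<ominus> a' \<otimes> r) \<oplus> a' \<otimes> r" using y a' by algebra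
      ultimately show "x \<in> J <+>\<^bsub>R\<^esub> right_multiples R a'" unfolding mem_sum_multiples using y(3) by blast
    qed
  qed
  have "\<one> \<in> ?Ia <+>\<^bsub>R\<^esub> right_multiples R b"
    using one Ia(2) unfolding mem_sum_multiples by blast
  then have "principal_right_ideal (J <+>\<^bsub>R\<^esub> right_multiples R a') R"
    unfolding sumJ using sum b unfolding principal_up_to_similarity_def by blast
  then obtain c where c: "c \<in> carrier R" "J <+>\<^bsub>R\<^esub> right_multiples R a' = right_multiples R c"
    unfolding principal_right_ideal_iff by blast
  note Ja = right_ideal_sum[OF J right_ideal_multiples[OF a']]
  have "a' \<in> right_multiples R c" using Ja(3) mem_multiples_self[OF a'] c by auto
  then obtain d where d: "d \<in> carrier R" "a' = c \<otimes> d" by (auto simp: right_multiples_def)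
  have "c \<in> J <+>\<^bsub>R\<^esub> right_multiples R a'" using c mem_multiples_self by simp
  then obtain y e where e: "y \<in> J" "e \<in> carrier R" "c = y \<oplus> a' \<otimes> e"
    unfolding mem_sum_multiples by blast
  \<comment> \<open>With a' = c d and c = y + a' e, where y is in J, one gets a'(1 - e d) = y d in
    J. So e generates R modulo a'^{-1}J, and goodness of a^{-1}I applies to the colon by e.\<close>
  have "a' = (y \<oplus> a' \<otimes> e) \<otimes> d" by (simp only: e(3)[symmetric] d(2)[symmetric])
  also have "\<dots> = y \<otimes> d \<oplus> a' \<otimes> e \<otimes> d" using j(5)[OF e(1)] e(2) d(1) a' by (simp add: l_distr)
  finally have ae: "a' = y \<otimes> d \<oplus> a' \<otimes> e \<otimes> d" .
  have "a' \<otimes> (\<one> \<ominus> e \<otimes> d) = a' \<ominus> a' \<otimes> e \<otimes> d" using a' e(2) d(1) r_one[OF a'] by algebra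
  also have "\<dots> = (y \<otimes> d \<oplus> a' \<otimes> e \<otimes> d) \<ominus> a' \<otimes> e \<otimes> d" using ae by simp
  also have "\<dots> = y \<otimes> d" using j(5)[OF e(1)] a' e(2) d(1) by algebra
  finally have "\<one> \<ominus> e \<otimes> d \<in> right_colon R a' J"
    using j(4)[OF e(1) d(1)] e(2) d(1) by (simp add: right_colon_def)
  moreover have "\<one> = (\<one> \<ominus> e \<otimes> d) \<oplus> e \<otimes> d" using e(2) d(1) by algebra
  ultimately have "\<one> \<in> right_colon R a' J <+>\<^bsub>R\<^esub> right_multiples R e"
    unfolding mem_sum_multiples using d by blast
  then have "principal_right_ideal (right_colon R e (right_colon R a' J)) R"
    using col e unfolding colJ principal_up_to_similarity_def by blast
  \<comment> \<open>Both sides are annihilators modulo J, of a' e and of c, and these differ by y in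
    J.\<close>
  moreover have "right_colon R e (right_colon R a' J) = right_colon R c J"
    unfolding right_colon_colon[OF a' e(2)]
  proof (rule right_colon_eqI[OF J, symmetric])
    have "c \<ominus> a' \<otimes> e = y" unfolding e(3) using j(5)[OF e(1)] a' e(2) by algebra
    then show "c \<ominus> a' \<otimes> e \<in> J" using e by simp
  qed (use c a' e in auto)
  ultimately obtain k where k: "k \<in> carrier R" "right_colon R c J = right_multiples R k"
    unfolding principal_right_ideal_iff by auto
  \<comment> \<open>Since J is contained in cR, its elements are the c r with r in c^{-1}J =
    kR.\<close>
  have "J = right_multiples R (c \<otimes> k)"
  proof
    show "right_multiples R (c \<otimes> k) \<subseteq> J"
      using mem_multiples_self[OF k(1)] by (intro right_multiples_subset[OF J]) (simp add: k(2)[symmetric] right_colon_def)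
    show "J \<subseteq> right_multiples R (c \<otimes> k)"
    proof
      fix x assume x: "x \<in> J"
      then obtain r where r: "r \<in> carrier R" "x = c \<otimes> r" using Ja(2) c by (auto simp: right_multiples_def)
      then have "r \<in> right_multiples R k" unfolding k(2)[symmetric] using x by (simp add: right_colon_def)
      then show "x \<in> right_multiples R (c \<otimes> k)" using r c k by (auto simp: right_multiples_def m_assoc)
    qed
  qed
  then show "principal_right_ideal (right_colon R b I) R"
    unfolding principal_right_ideal_iff J_def[symmetric] using c k by blast
qed

end

section \<open>Principal right ideal rings\<close>

text \<open>Ascending chains in M pull back to chains above B, and surjectivity of \<open>f\<close>
  recovers the original chain from its preimages.\<close>

lemma right_epi_noetherian:
  assumes "right_epi R X A M f B"
    and acc: "\<And>C :: nat \<Rightarrow> 'x set. (\<And>i. right_submodule R (C i) X) \<Longrightarrow> (\<And>i. B \<subseteq> C i) \<Longrightarrow>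
      (\<And>i. C i \<subseteq> C (Suc i)) \<Longrightarrow> \<exists>n. \<forall>i\<ge>n. C i = C n"
  shows "noetherian_right_module R M"
  unfolding noetherian_right_module_def
proof (intro conjI allI impI)
  note e = right_epiD[OF assms(1)]
  show "right_module R M" by (fact e)
  fix C assume C: "(\<forall>i. right_submodule R (C i) M) \<and> (\<forall>i. C i \<subseteq> C (Suc i))"
  let ?D = "\<lambda>i. {x \<in> A. f x \<in> C i}"
  have "\<exists>n. \<forall>i\<ge>n. ?D i = ?D n"
  proof (rule acc)
    show "right_submodule R (?D i) X" for i using right_epi_vimage_submodule[OF assms(1)] C by blast
    show "B \<subseteq> ?D i" for i unfolding e(7) using right_submodule_closed(1)[OF e(3)] C by auto
    show "?D i \<subseteq> ?D (Suc i)" for i using C by blast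
  qed
  then obtain n where n: "\<forall>i\<ge>n. ?D i = ?D n" ..
  have "f ` ?D i = C i" for i using right_epi_image_vimage[OF assms(1)] C by blast
  with n have "\<forall>i\<ge>n. C i = C n" by metis
  then show "\<exists>n. \<forall>i\<ge>n. C i = C n" ..
qed

lemma right_ideal_UN:
  assumes "ring R" "\<And>I. I \<in> \<I> \<Longrightarrow> right_ideal I R" "\<I> \<noteq> {}"
    and dir: "\<And>I J. I \<in> \<I> \<Longrightarrow> J \<in> \<I> \<Longrightarrow> I \<subseteq> J \<or> J \<subseteq> I"
  shows "right_ideal (\<Union>\<I>) R"
proof -
  interpret ring R by (fact assms)
  note i = right_idealD[OF assms(2)]
  show ?thesis
  proof (rule right_idealI)
    show "\<zero>\<^bsub>R\<^esub> \<in> \<Union>\<I>" using assms(3) i(1) by blast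
    show "\<Union>\<I> \<subseteq> carrier R" using i(2) by blast
    show "x \<otimes>\<^bsub>R\<^esub> r \<in> \<Union>\<I>" if "x \<in> \<Union>\<I>" "r \<in> carrier R" for x r
      using that i(4) by blast
    show "x \<oplus>\<^bsub>R\<^esub> y \<in> \<Union>\<I>" if xy: "x \<in> \<Union>\<I>" "y \<in> \<Union>\<I>" for x y
    proof -
      obtain I J where "I \<in> \<I>" "J \<in> \<I>" "x \<in> I" "y \<in> J" using xy by blast
      with dir[of I J] i(3)[of I x y] i(3)[of J x y] show ?thesis by blast
    qed
  qed
qed

context ring
begin

text \<open>The map r to ar + I reaches all of (I + aR)/I because the component in I dies. With I +
  aR = R it yields similarity; with aR inside a critical submodule it yields cocritical
  annihilators.\<close>

lemma right_epi_colon: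
  assumes I: "right_ideal I R" and a: "a \<in> carrier R"
  shows "right_epi R (regular_module R) (carrier R)
    (quotient_module ((regular_module R)\<lparr>carrier := I <+>\<^bsub>R\<^esub> right_multiples R a\<rparr>) I)
    (\<lambda>r. I +>\<^bsub>regular_module R\<^esub> (a \<otimes> r)) (right_colon R a I)"
proof -
  let ?D = "I <+>\<^bsub>R\<^esub> right_multiples R a" and ?X = "regular_module R"
  note X = right_module_regular[OF ring_axioms]
  note D = right_ideal_sum[OF I right_ideal_multiples[OF a]]
  define q where "q x = I +>\<^bsub>?X\<^esub> x" for x
  define Q where "Q = quotient_module (?X\<lparr>carrier := ?D\<rparr>) I"
  have q: "right_epi R ?X ?D Q q I"
    unfolding q_def Q_def using right_epi_quotient[OF X _ _ D(2)] D(1) I unfolding right_ideal_def by blast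
  note e = right_epiD[OF q, simplified]
  interpret Q: right_module R Q by (fact e)
  have aD: "a \<otimes> r \<in> ?D" if "r \<in> carrier R" for r
    using D(3) that by (auto simp: right_multiples_def)
  have "right_epi R ?X (carrier R) Q (\<lambda>r. q (a \<otimes> r)) (right_colon R a I)"
  proof (rule right_epiI[OF X _ e(3)])
    show "right_submodule R (carrier R) ?X" using right_ideal_carrier by (simp add: right_ideal_def)
    show "(\<lambda>r. q (a \<otimes> r)) ` carrier R = carrier Q"
    proof
      show "(\<lambda>r. q (a \<otimes> r)) ` carrier R \<subseteq> carrier Q" using e(8) aD by auto
      show "carrier Q \<subseteq> (\<lambda>r. q (a \<otimes> r)) ` carrier R"
      proof
        fix y assume "y \<in> carrier Q"
        then obtain x where "x \<in> ?D" "y = q x" using e(4) by blast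
        then obtain i r where i: "i \<in> I" "r \<in> carrier R" "y = q (i \<oplus> a \<otimes> r)"
          unfolding mem_sum_multiples by blast
        have "q i = \<zero>\<^bsub>Q\<^esub>" "i \<in> ?D" using i(1) e(7) D(2) by auto
        then have "y = q (a \<otimes> r)" using e(5)[of i "a \<otimes> r"] aD[OF i(2)] e(8) i(3) by simp
        then show "y \<in> (\<lambda>r. q (a \<otimes> r)) ` carrier R" using i(2) by blast
      qed
    qed
    show "right_colon R a I = {x \<in> carrier R. q (a \<otimes> x) = \<zero>\<^bsub>Q\<^esub>}"
      unfolding right_colon_def using e(7) aD by auto
  qed (use a e(5,6) aD in \<open>simp_all add: r_distr m_assoc[symmetric]\<close>)
  then show ?thesis by (simp add: q_def Q_def)
qed

lemma right_epi_regular_quotient: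
  assumes "right_ideal I R"
  shows "right_epi R (regular_module R) (carrier R) (quotient_module (regular_module R) I)
    (\<lambda>r. I +>\<^bsub>regular_module R\<^esub> r) I"
  using right_epi_quotient_full[OF right_module_regular[OF ring_axioms] assms[unfolded right_ideal_def]]
  by simp

text \<open>Here (I + aR)/I is all of R/I, so R/I has a second presentation by R, with kernel
  a^{-1}I.\<close>

lemma similar_right_colon:
  assumes I: "right_ideal I R" and a: "a \<in> carrier R" and one: "\<one> \<in> I <+>\<^bsub>R\<^esub> right_multiples R a"
  shows "similar_right_ideals R (right_colon R a I) I"
proof -
  have "I <+>\<^bsub>R\<^esub> right_multiples R a = carrier R"
    using right_ideal_one[OF right_ideal_sum(1)[OF I right_ideal_multiples[OF a]] one] .
  moreover have "(regular_module R)\<lparr>carrier := carrier R\<rparr> = regular_module R"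
    by (simp add: regular_module_def)
  ultimately have "right_epi R (regular_module R) (carrier R) (quotient_module (regular_module R) I)
    (\<lambda>r. I +>\<^bsub>regular_module R\<^esub> (a \<otimes> r)) (right_colon R a I)"
    using right_epi_colon[OF I a] by (simp only:)
  then show ?thesis
    unfolding similar_right_ideals_def
    using right_epi_iso[OF right_epi_regular_quotient] right_ideal_colon[OF I a] I by blast
qed

text \<open>A nonzero element of R/I is the coset of some a outside I, and its annihilator is
  a^{-1}I.\<close>

lemma point_annihilators_quotient:
  assumes I: "right_ideal I R" and J: "J \<in> point_annihilators R (quotient_module (regular_module R) I)"
  obtains a where "a \<in> carrier R" "a \<notin> I" "J = right_colon R a I"
proof -
  let ?Q = "quotient_module (regular_module R) I" and ?q = "\<lambda>r. I +>\<^bsub>regular_module R\<^esub> r"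
  note e = right_epiD[OF right_epi_regular_quotient[OF I], simplified]
  obtain m where m: "m \<in> carrier ?Q" "m \<noteq> \<zero>\<^bsub>?Q\<^esub>" "J = annihilator R ?Q m"
    using J by (auto simp: point_annihilators_def)
  obtain a where a: "a \<in> carrier R" "m = ?q a" using m(1) e(4) by blast
  have qI: "?q x = \<zero>\<^bsub>?Q\<^esub> \<longleftrightarrow> x \<in> I" if "x \<in> carrier R" for x
    using that e(7) by blast
  have "m \<triangleleft>\<^bsub>?Q\<^esub> r = \<zero>\<^bsub>?Q\<^esub> \<longleftrightarrow> a \<otimes> r \<in> I" if "r \<in> carrier R" for r
    unfolding a(2) e(6)[OF a(1) that, symmetric] using a(1) that by (intro qI) simp
  then have "J = right_colon R a I"
    unfolding m(3) annihilator_def right_colon_def by blast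
  moreover have "a \<notin> I" using m(2) qI a by simp
  ultimately show ?thesis using that a by blast
qed

lemma zero_module_quotient:
  assumes I: "right_ideal I R" "I \<noteq> carrier R"
  shows "\<not> zero_module (quotient_module (regular_module R) I)"
  using right_epiD(7,8)[OF right_epi_regular_quotient[OF I(1)]] I(2) by (auto simp: zero_module_def)

section \<open>Essential right ideals and complements\<close>

lemma essential_right_ideal_iff:
  "essential_right_ideal I R \<longleftrightarrow> right_ideal I R \<and> (\<forall>K. right_ideal K R \<and> K \<noteq> {\<zero>} \<longrightarrow> I \<inter> K \<noteq> {\<zero>})"
  by (simp add: essential_right_ideal_def essential_submodule_def right_ideal_def)

lemma right_ideal_nontrivial_inter:
  assumes "right_ideal I R" "right_ideal K R"
  shows "I \<inter> K \<noteq> {\<zero>} \<longleftrightarrow> (\<exists>x\<in>I \<inter> K. x \<noteq> \<zero>)"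
  using right_idealD(1)[OF assms(1)] right_idealD(1)[OF assms(2)] by blast

lemma essential_right_ideal_mono:
  assumes "essential_right_ideal I R" "right_ideal J R" "I \<subseteq> J"
  shows "essential_right_ideal J R"
  using assms right_idealD(1) unfolding essential_right_ideal_iff by blast

text \<open>If aK = 0, then K lies in a^{-1}I altogether. Otherwise aK is a nonzero right ideal, and
  a nonzero ay in I with y in K gives a nonzero y in the intersection.\<close>

lemma essential_right_colon:
  assumes I: "essential_right_ideal I R" and a: "a \<in> carrier R"
  shows "essential_right_ideal (right_colon R a I) R"
proof -
  have rI: "right_ideal I R" using I by (simp add: essential_right_ideal_iff)
  note col = right_ideal_colon[OF rI a]
  have "right_colon R a I \<inter> K \<noteq> {\<zero>}" if K: "right_ideal K R" "K \<noteq> {\<zero>}" for K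
  proof (cases "\<forall>k\<in>K. a \<otimes> k = \<zero>")
    case True
    then have "K \<subseteq> right_colon R a I"
      using right_idealD(1)[OF rI] right_idealD(5)[OF K(1)] by (auto simp: right_colon_def)
    then show ?thesis using K by blast
  next
    case False
    note k = right_idealD[OF K(1)]
    let ?aK = "(\<lambda>k. a \<otimes> k) ` K"
    have aK: "right_ideal ?aK R"
    proof (rule right_idealI)
      show "\<zero> \<in> ?aK" using k(1) a by (auto intro!: image_eqI[of _ _ \<zero>])
      show "x \<oplus> y \<in> ?aK" if "x \<in> ?aK" "y \<in> ?aK" for x y
        using that k(3,5) a by (auto simp: r_distr[symmetric])
      show "x \<otimes> r \<in> ?aK" if "x \<in> ?aK" "r \<in> carrier R" for x r
        using that k(4,5) a by (auto simp: m_assoc)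
    qed (use k(5) a in auto)
    moreover have "?aK \<noteq> {\<zero>}" using False by auto
    ultimately have "I \<inter> ?aK \<noteq> {\<zero>}"
      using I unfolding essential_right_ideal_iff by blast
    then obtain x where "x \<in> I \<inter> ?aK" "x \<noteq> \<zero>"
      unfolding right_ideal_nontrivial_inter[OF rI aK] by blast
    then obtain y where "y \<in> K" "a \<otimes> y \<in> I" "a \<otimes> y \<noteq> \<zero>" by auto
    then have "y \<in> right_colon R a I \<inter> K" "y \<noteq> \<zero>" using k(5) a by (auto simp: right_colon_def)
    then show ?thesis by blast
  qed
  then show ?thesis using col by (simp add: essential_right_ideal_iff)
qed

text \<open>C is maximal among the right ideals meeting I trivially. A nonzero K meeting I + C
  trivially could be added to C, against maximality.\<close>

lemma exists_essential_complement:
  assumes I: "right_ideal I R"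
  obtains C where "right_ideal C R" "I \<inter> C = {\<zero>}" "essential_right_ideal (I <+>\<^bsub>R\<^esub> C) R"
proof -
  note i = right_idealD[OF I]
  let ?F = "{C. right_ideal C R \<and> I \<inter> C = {\<zero>}}"
  have z: "{\<zero>} \<in> ?F" using i(1) by (auto intro!: right_idealI)
  have "\<exists>M\<in>?F. \<forall>X\<in>?F. M \<subseteq> X \<longrightarrow> X = M"
  proof (rule subset_Zorn_nonempty)
    show "?F \<noteq> {}" using z by blast
    fix \<C> assume \<C>: "\<C> \<noteq> {}" "subset.chain ?F \<C>"
    have "right_ideal (\<Union>\<C>) R"
      by (rule right_ideal_UN[OF ring_axioms]) (use \<C> in \<open>auto simp: subset_chain_def\<close>)
    then show "\<Union>\<C> \<in> ?F" using \<C> unfolding subset_chain_def by auto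
  qed
  then obtain C where "C \<in> ?F" and "\<forall>X\<in>?F. C \<subseteq> X \<longrightarrow> X = C" by (elim bexE)
  then have C: "right_ideal C R" "I \<inter> C = {\<zero>}"
    and max: "\<And>D. right_ideal D R \<Longrightarrow> I \<inter> D = {\<zero>} \<Longrightarrow> C \<subseteq> D \<Longrightarrow> D = C"
    by simp_all
  note c = right_idealD[OF C(1)]
  note IC = right_ideal_sum[OF I C(1)]
  have "(I <+>\<^bsub>R\<^esub> C) \<inter> K \<noteq> {\<zero>}" if K: "right_ideal K R" "K \<noteq> {\<zero>}" for K
  proof
    assume 0: "(I <+>\<^bsub>R\<^esub> C) \<inter> K = {\<zero>}"
    note k = right_idealD[OF K(1)]
    note CK = right_ideal_sum[OF C(1) K(1)]
    have "x = \<zero>" if x: "x \<in> I" "x \<in> C <+>\<^bsub>R\<^esub> K" for x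
    proof -
      obtain y z where y: "y \<in> C" "z \<in> K" "x = y \<oplus> z" using x by (auto simp: set_add_def')
      \<comment> \<open>The K-component z of x is also x - y, hence lies in I + C and vanishes; then
        x = y is in both I and C.\<close>
      have "z = x \<oplus> \<ominus> y" unfolding y(3) using c(5)[OF y(1)] k(5)[OF y(2)] by algebra
      moreover have "\<dots> \<in> I <+>\<^bsub>R\<^esub> C" using x(1) c(6)[OF y(1)] unfolding set_add_def' by blast
      ultimately have "z = \<zero>" using 0 y(2) by blast
      then have "x = y" using y c(5) by simp
      then show ?thesis using x y C(2) by blast
    qed
    then have "I \<inter> (C <+>\<^bsub>R\<^esub> K) = {\<zero>}" using i(1) right_idealD(1)[OF CK(1)] by blast
    then have "K \<subseteq> C" using max[OF CK(1)] CK(2,3) by blast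
    then have "K \<subseteq> (I <+>\<^bsub>R\<^esub> C) \<inter> K" using IC(3) by blast
    then show False using 0 K k(1) by blast
  qed
  then show ?thesis using that[OF C] IC(1) by (simp add: essential_right_ideal_iff)
qed

text \<open>The I-component y of a generator x = y + z generates I: if j = x r is in I, then z r = j
  - y r lies in both I and C, so it is zero.\<close>

lemma principal_right_summand:
  assumes I: "right_ideal I R" and C: "right_ideal C R" and IC: "I \<inter> C = {\<zero>}"
    and "principal_right_ideal (I <+>\<^bsub>R\<^esub> C) R"
  shows "principal_right_ideal I R"
proof -
  note i = right_idealD[OF I] and c = right_idealD[OF C]
  obtain x where x: "x \<in> carrier R" "I <+>\<^bsub>R\<^esub> C = right_multiples R x"
    using assms(4) unfolding principal_right_ideal_iff by blast
  then obtain y z where y: "y \<in> I" "z \<in> C" "x = y \<oplus> z"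
    using mem_multiples_self[OF x(1)] unfolding x(2)[symmetric] set_add_def' by blast
  have "I \<subseteq> right_multiples R y"
  proof
    fix j assume j: "j \<in> I"
    then obtain r where r: "r \<in> carrier R" "j = x \<otimes> r"
      using right_ideal_sum(2)[OF I C] x(2) by (auto simp: right_multiples_def)
    have yr: "y \<otimes> r \<in> I" "z \<otimes> r \<in> C" using i(4) c(4) y r by auto
    have "j \<ominus> y \<otimes> r = z \<otimes> r"
      unfolding r(2) y(3) using i(5)[OF y(1)] c(5)[OF y(2)] r(1) by algebra
    then have "z \<otimes> r = \<zero>" using IC yr i(7)[OF j yr(1)] by auto
    then have "j = y \<otimes> r" using r y(3) i(5)[OF y(1)] c(5)[OF y(2)] by (simp add: l_distr)
    then show "j \<in> right_multiples R y" using r by (auto simp: right_multiples_def)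
  qed
  then have "I = right_multiples R y" using right_multiples_subset[OF I y(1)] by blast
  then show ?thesis unfolding principal_right_ideal_iff using i(5)[OF y(1)] by blast
qed

theorem principal_right_ideal_ring_criterion:
  assumes S: "right_noetherian_point_annihilator_set R S" "closed_under_similarity R S"
    and ess: "\<And>I. essential_right_ideal I R \<Longrightarrow> I \<in> S \<Longrightarrow> principal_right_ideal I R"
  shows "principal_right_ideal_ring R"
proof -
  let ?good = "principal_up_to_similarity R"
  have essential: "principal_right_ideal E R" if E: "essential_right_ideal E R" for E
  proof (rule ccontr)
    assume np: "\<not> principal_right_ideal E R"
    have rE: "right_ideal E R" using E by (simp add: essential_right_ideal_iff)
    \<comment> \<open>Lying above E makes every member essential.\<close>
    let ?F = "{J. right_ideal J R \<and> E \<subseteq> J \<and> \<not> ?good J}"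
    have EF: "E \<in> ?F" using rE np principal_up_to_similarity_principal by blast
    have "\<exists>M\<in>?F. \<forall>X\<in>?F. M \<subseteq> X \<longrightarrow> X = M"
    proof (rule subset_Zorn_nonempty)
      show "?F \<noteq> {}" using EF by blast
      fix \<C> assume \<C>: "\<C> \<noteq> {}" "subset.chain ?F \<C>"
      have U: "right_ideal (\<Union>\<C>) R"
        by (rule right_ideal_UN[OF ring_axioms]) (use \<C> in \<open>auto simp: subset_chain_def\<close>)
      \<comment> \<open>A good union would be principal; its generator already lies in some member
        of the chain, which then equals the union and would be good.\<close>
      have "\<not> ?good (\<Union>\<C>)"
      proof
        assume g: "?good (\<Union>\<C>)"
        obtain x where x: "x \<in> carrier R" "\<Union>\<C> = right_multiples R x"
          using principal_up_to_similarity_principal[OF U g] unfolding principal_right_ideal_iff by blast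
        then obtain J where J: "J \<in> \<C>" "x \<in> J" using mem_multiples_self by blast
        have "right_ideal J R" "\<not> ?good J" using J \<C>(2) by (auto simp: subset_chain_def)
        then have "\<Union>\<C> \<subseteq> J" using x J right_multiples_subset by auto
        then have "\<Union>\<C> = J" using J by blast
        then show False using g \<open>\<not> ?good J\<close> by simp
      qed
      then show "\<Union>\<C> \<in> ?F" using U \<C> unfolding subset_chain_def by blast
    qed
    then obtain I where "I \<in> ?F" and maxF: "\<forall>X\<in>?F. I \<subseteq> X \<longrightarrow> X = I" by (elim bexE)
    then have I: "right_ideal I R" "E \<subseteq> I" "\<not> ?good I" by simp_all
    have max: "?good J" if J: "right_ideal J R" "I \<subset> J" for J
    proof (rule ccontr)
      assume "\<not> ?good J"
      then have "J \<in> ?F" using J I(2) by auto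
      then show False using maxF J(2) by blast
    qed
    have eI: "essential_right_ideal I R" using essential_right_ideal_mono[OF E I(1,2)] .
    \<comment> \<open>All colons of R are R = 1R. Hence I is proper and R/I is nonzero, as the
      hypothesis on S requires.\<close>
    have "?good (carrier R)"
    proof -
      have "right_colon R a (carrier R) = right_multiples R \<one>" if "a \<in> carrier R" for a
        using that by (auto simp: right_colon_def right_multiples_def image_iff)
      then show ?thesis
        unfolding principal_up_to_similarity_def principal_right_ideal_iff by blast
    qed
    then have nz: "I \<noteq> carrier R" using I(3) by auto
    let ?Q = "quotient_module (regular_module R) I"
    have "noetherian_right_module R ?Q"
    proof (rule right_epi_noetherian[OF right_epi_regular_quotient[OF I(1)]])
      fix C :: "nat \<Rightarrow> 'a set"
      assume C: "\<And>i. right_submodule R (C i) (regular_module R)" "\<And>i. I \<subseteq> C i" "\<And>i. C i \<subseteq> C (Suc i)"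
      have rC: "right_ideal (C i) R" for i using C(1) by (simp add: right_ideal_def)
      have mono: "C i \<subseteq> C j" if "i \<le> j" for i j using that C(3) by (rule lift_Suc_mono_le[rotated])
      have "C i \<subseteq> C j \<or> C j \<subseteq> C i" for i j using mono nat_le_linear by blast
      then have U: "right_ideal (\<Union>(range C)) R"
        by (intro right_ideal_UN[OF ring_axioms]) (use rC in blast)+
      show "\<exists>n. \<forall>i\<ge>n. C i = C n"
      \<comment> \<open>A union equal to I forces a constant chain. Otherwise the union lies
        strictly above I, so it is principal, and the chain stops where its generator
        appears.\<close>
      proof (cases "\<Union>(range C) = I")
        case True
        then show ?thesis using C(2) by blast
      next
        case False
        then have "principal_right_ideal (\<Union>(range C)) R"
          using max[OF U] C(2) principal_up_to_similarity_principal[OF U] by blast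
        then obtain x where x: "x \<in> carrier R" "\<Union>(range C) = right_multiples R x"
          unfolding principal_right_ideal_iff by blast
        then obtain n where n: "x \<in> C n" using mem_multiples_self by blast
        have "C i = C n" if "i \<ge> n" for i
          using right_multiples_subset[OF rC n] mono[OF that] x(2) by blast
        then show ?thesis by blast
      qed
    qed
    then obtain J where J: "J \<in> point_annihilators R ?Q" "J \<in> S"
      using right_noetherian_point_annihilator_setD[OF S(1)] zero_module_quotient[OF I(1) nz] by blast
    obtain a where a: "a \<in> carrier R" "a \<notin> I" "J = right_colon R a I"
      using point_annihilators_quotient[OF I(1) J(1)] .
    have rJ: "right_ideal J R" unfolding a(3) by (rule right_ideal_colon[OF I(1) a(1)])
    have eJ: "essential_right_ideal J R" unfolding a(3) by (rule essential_right_colon[OF eI a(1)])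
    \<comment> \<open>The right ideals similar to J are again in S and, being colons of an essential
      right ideal, essential; the hypothesis makes each of them principal.\<close>
    have "?good J"
      unfolding principal_up_to_similarity_def
    proof (intro ballI impI)
      fix b assume b: "b \<in> carrier R" "\<one> \<in> J <+>\<^bsub>R\<^esub> right_multiples R b"
      have "right_colon R b J \<in> S"
        using similar_right_colon[OF rJ b] J(2) S(2) unfolding closed_under_similarity_def by blast
      then show "principal_right_ideal (right_colon R b J) R"
        using ess essential_right_colon[OF eJ b(1)] by blast
    qed
    moreover have "?good (I <+>\<^bsub>R\<^esub> right_multiples R a)"
      using right_ideal_sum[OF I(1) right_ideal_multiples[OF a(1)]] mem_multiples_self[OF a(1)] a(2)
      by (intro max) blast+
    ultimately have "?good I" using principal_up_to_similarity_Oka[OF I(1) a(1)] a(3) by blast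
    then show False using I(3) by simp
  qed
  have "principal_right_ideal I R" if I: "right_ideal I R" for I
  proof -
    obtain C where C: "right_ideal C R" "I \<inter> C = {\<zero>}" "essential_right_ideal (I <+>\<^bsub>R\<^esub> C) R"
      using exists_essential_complement[OF I] .
    then show ?thesis using principal_right_summand[OF I] essential by blast
  qed
  then show ?thesis unfolding principal_right_ideal_ring_def using ring_axioms by blast
qed

end

section \<open>Ranks of well-founded relations\<close>

text \<open>For well-founded \<open>r\<close> this compares ordinal ranks without mentioning
  ordinals, the rank of x being the least ordinal above the ranks of its predecessors.\<close>

inductive rank_le :: "'b rel \<Rightarrow> 'b \<Rightarrow> 'b \<Rightarrow> bool" for r where
  "(\<And>x'. (x', x) \<in> r \<Longrightarrow> \<exists>y'. (y', y) \<in> r \<and> rank_le r x' y') \<Longrightarrow> rank_le r x y"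

lemma rank_le_iff:
  "rank_le r x y \<longleftrightarrow> (\<forall>x'. (x', x) \<in> r \<longrightarrow> (\<exists>y'. (y', y) \<in> r \<and> rank_le r x' y'))"
  by (subst rank_le.simps) blast

context
  fixes r :: "'b rel"
  assumes wf: "wf r"
begin

lemma rank_le_refl: "rank_le r x x"
  using wf
proof (induction x rule: wf_induct_rule)
  case (less x)
  then show ?case by (subst rank_le_iff) blast
qed

lemma rank_le_trans: "rank_le r x y \<Longrightarrow> rank_le r y z \<Longrightarrow> rank_le r x z"
  using wf
proof (induction x arbitrary: y z rule: wf_induct_rule)
  case (less x)
  show ?case
    unfolding rank_le_iff[of r x z]
  proof (intro allI impI)
    fix x' assume x': "(x', x) \<in> r"
    then obtain y' where y': "(y', y) \<in> r" "rank_le r x' y'"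
      using less.prems(1) unfolding rank_le_iff[of r x y] by blast
    then obtain z' where "(z', z) \<in> r" "rank_le r y' z'"
      using less.prems(2) unfolding rank_le_iff[of r y z] by blast
    then show "\<exists>z'. (z', z) \<in> r \<and> rank_le r x' z'" using less.IH[OF x' y'(2)] by blast
  qed
qed

text \<open>Some predecessor x' of x is bounded by no predecessor of y. Induction at x' then puts
  every predecessor of y below some predecessor of x', which says that y is at most x'.\<close>

lemma not_rank_le_step: "\<not> rank_le r x y \<Longrightarrow> \<exists>x'. (x', x) \<in> r \<and> rank_le r y x'"
  using wf
proof (induction x arbitrary: y rule: wf_induct_rule)
  case (less x)
  obtain x' where x': "(x', x) \<in> r" "\<And>y'. (y', y) \<in> r \<Longrightarrow> \<not> rank_le r x' y'"
    using less.prems unfolding rank_le_iff[of r x y] by blast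
  have "rank_le r y x'"
    unfolding rank_le_iff[of r y x'] using less.IH[OF x'(1)] x'(2) by blast
  then show ?case using x'(1) by blast
qed

text \<open>A violation at (y, x) produces a violation at (y', y) with y' below y, so there is no
  minimal one.\<close>

lemma rank_le_strict: "(y, x) \<in> r \<Longrightarrow> \<not> rank_le r x y"
  using wf
proof (induction y arbitrary: x rule: wf_induct_rule)
  case (less y)
  show ?case
  proof
    assume "rank_le r x y"
    then obtain y' where "(y', y) \<in> r" "rank_le r y y'"
      using less.prems unfolding rank_le_iff[of r x y] by blast
    then show False using less.IH by blast
  qed
qed

lemma rank_le_step: "(y, x) \<in> r \<Longrightarrow> rank_le r y x"
  using wf
proof (induction y arbitrary: x rule: wf_induct_rule)
  case (less y)
  show ?case
    unfolding rank_le_iff[of r y x] using less.IH less.prems by blast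
qed

lemma rank_le_total: "rank_le r x y \<or> rank_le r y x"
  using not_rank_le_step[of x y] rank_le_step rank_le_trans by blast

text \<open>Accessibility is proved at once for all y of rank at most x, by induction on x: anything
  of smaller rank than y is bounded by a predecessor of y, hence by a predecessor of x.\<close>

lemma wf_rank_less: "wf {(y, x). \<not> rank_le r x y}"
proof -
  have "y \<in> Wellfounded.acc {(y, x). \<not> rank_le r x y}" if "rank_le r y x" for x y
    using wf that
  proof (induction x arbitrary: y rule: wf_induct_rule)
    case (less x)
    show ?case
    proof (rule accI)
      fix z assume "(z, y) \<in> {(y, x). \<not> rank_le r x y}"
      then obtain y' where y': "(y', y) \<in> r" "rank_le r z y'" using not_rank_le_step[of y z] by blast
      then obtain x' where x': "(x', x) \<in> r" "rank_le r y' x'"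
        using less.prems unfolding rank_le_iff[of r y x] by blast
      then show "z \<in> Wellfounded.acc {(y, x). \<not> rank_le r x y}"
        using less.IH[OF x'(1)] rank_le_trans[OF y'(2)] by blast
    qed
  qed
  then show ?thesis using rank_le_refl by (intro acc_wfI) blast
qed

text \<open>The rank of \<open>x\<close> is the well-order of the lower sets of the elements of smaller rank.\<close>

lemma wf_rank:
  obtains \<rho> :: "'b \<Rightarrow> 'b set rel"
  where "\<And>x. Well_order (\<rho> x)" "\<And>x y. (y, x) \<in> r \<Longrightarrow> (\<rho> y, \<rho> x) \<in> ordLess"
proof -
  \<comment> \<open>Strict lower sets merge elements of equal rank, so inclusion among them is
    antisymmetric, as a well-order needs.\<close>
  define D where "D x = {y. \<not> rank_le r x y}" for x
  have D: "D x \<subseteq> D y \<longleftrightarrow> rank_le r x y" for x y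
    unfolding D_def using rank_le_refl rank_le_trans rank_le_total by blast
  define W where "W = {(A, B). A \<in> range D \<and> B \<in> range D \<and> A \<subseteq> B}"
  have F: "Field W = range D" unfolding W_def Field_def by auto
  \<comment> \<open>A chosen element represents each lower set, and strict comparison of ranks is
    already well-founded.\<close>
  have "wf (W - Id)"
  proof (rule wf_subset[OF wf_inv_image[OF wf_rank_less, of "inv_into UNIV D"]])
    have "D (inv_into UNIV D A) = A" if "A \<in> range D" for A using that by (simp add: f_inv_into_f)
    then show "W - Id \<subseteq> inv_image {(y, x). \<not> rank_le r x y} (inv_into UNIV D)"
      unfolding W_def inv_image_def D[symmetric] by auto
  qed
  moreover have "Linear_order W"
    unfolding linear_order_on_def partial_order_on_def preorder_on_def F
    using D rank_le_total
    by (auto simp: W_def refl_on_def trans_def antisym_def total_on_def)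
  ultimately have W: "Well_order W" by (simp add: well_order_on_def)
  then interpret W: wo_rel W by (simp add: wo_rel_def)
  \<comment> \<open>The initial segment of \<open>W\<close> strictly below D x; a predecessor of x
    has a properly smaller segment.\<close>
  define \<rho> where "\<rho> x = Restr W (underS W (D x))" for x
  have "Well_order (\<rho> x)" for x unfolding \<rho>_def by (rule Well_order_Restr[OF W])
  moreover have "(\<rho> y, \<rho> x) \<in> ordLess" if "(y, x) \<in> r" for x y
  proof -
    have yx: "D y \<subseteq> D x" "D y \<noteq> D x"
      using D rank_le_step[OF that] rank_le_strict[OF that] by blast+
    then have "underS W (D y) \<subset> underS W (D x)"
      unfolding Order_Relation.underS_def W_def by auto
    then show ?thesis
      unfolding \<rho>_def using ofilter_subset_ordLess[OF W] W.underS_ofilter by blast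
  qed
  ultimately show ?thesis using that by blast
qed

end

section \<open>The order on ordinals with -1 adjoined\<close>

lemma wf_kord_less: "wf {(\<beta>, \<alpha>). kord_less \<beta> \<alpha>}"
proof (rule wfI_min)
  fix \<alpha> :: "'o rel option" and Q assume \<alpha>: "\<alpha> \<in> Q"
  show "\<exists>z\<in>Q. \<forall>y. (y, z) \<in> {(\<beta>, \<alpha>). kord_less \<beta> \<alpha>} \<longrightarrow> y \<notin> Q"
  proof (cases "None \<in> Q")
    case True
    then show ?thesis by (auto simp: kord_less_def intro!: bexI[of _ None])
  next
    case False
    then obtain s where "s \<in> {s. Some s \<in> Q}" using \<alpha> by (cases \<alpha>) auto
    from wfE_min[OF wf_ordLess this] obtain z
      where z: "Some z \<in> Q" "\<And>y. (y, z) \<in> ordLess \<Longrightarrow> Some y \<notin> Q" by auto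
    have "y \<notin> Q" if "kord_less y (Some z)" for y
      using that z False by (cases y) (auto simp: kord_less_def)
    then show ?thesis using z by blast
  qed
qed

lemma kord_less_trans:
  assumes "kord_less \<alpha> \<beta>" "kord_less \<beta> \<gamma>"
  shows "kord_less \<alpha> \<gamma>"
proof -
  obtain s where s: "\<beta> = Some s" using assms(1) by (cases \<beta>) (auto simp: kord_less_def)
  obtain t where t: "\<gamma> = Some t" using assms(2) by (cases \<gamma>) (auto simp: kord_less_def)
  have st: "(s, t) \<in> ordLess" using assms(2) by (simp add: s t kord_less_def)
  \<comment> \<open>Comparison of -1 with \<open>t\<close> includes that \<open>t\<close> is a
    well-order, so the case \<alpha> = -1 needs this fact.\<close>
  then have "Well_order t" by (simp add: ordLess_def)
  then show ?thesis
    using assms(1) st by (cases \<alpha>) (auto simp: s t kord_less_def intro: ordLess_transitive)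
qed

section \<open>Krull dimension as deviation of submodule lattices\<close>

text \<open>The deviation of the interval between B and A in the submodule lattice. Only members of
  chains have to be submodules; the end points are arbitrary sets, which keeps side conditions out
  of the lemmas on intervals.\<close>

inductive deviation ::
    "('a, 'k) ring_scheme \<Rightarrow> ('a, 'x, 'l) right_mod_scheme \<Rightarrow> 'o rel option \<Rightarrow> 'x set \<Rightarrow> 'x set \<Rightarrow> bool"
  for R X where
  minus_one: "deviation R X None A A"
| ordinal: "\<lbrakk>Well_order \<alpha>;
     \<And>C :: nat \<Rightarrow> 'x set.
       \<lbrakk>\<And>i. right_submodule R (C i) X; \<And>i. B \<subseteq> C i; \<And>i. C i \<subseteq> A; \<And>i. C (Suc i) \<subseteq> C i\<rbrakk>
       \<Longrightarrow> \<exists>n. \<forall>i\<ge>n. \<exists>\<beta>. kord_less \<beta> (Some \<alpha>) \<and> deviation R X \<beta> (C i) (C (Suc i))\<rbrakk>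
   \<Longrightarrow> deviation R X (Some \<alpha>) A B"

inductive_cases deviation_NoneE: "deviation R X None A B"
inductive_cases deviation_SomeE: "deviation R X (Some \<alpha>) A B"

lemma krull_class_right_module: "krull_class R \<alpha> M \<Longrightarrow> right_module R M"
  by (cases rule: krull_class.cases) auto

text \<open>The induction must vary the presentation: the factors of a chain in X are presented by
  other pairs of submodules of X, through the factors of the image chain in M.\<close>

lemma krull_class_imp_deviation:
  fixes X :: "('a, 'x, 'l) right_mod_scheme" and M :: "('a, 'm) right_mod"
  assumes "krull_class R \<alpha> M" "right_epi R X A M f B"
  shows "deviation R X \<alpha> A B"
  using assms
proof (induction arbitrary: A f B rule: krull_class.induct)
  case (minus_one M)
  note e = right_epiD[OF minus_one.prems]
  have "f x = \<zero>\<^bsub>M\<^esub>" if "x \<in> A" for x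
    using e(8)[OF that] minus_one.hyps(2) by (simp add: zero_module_def)
  then have "B = A" unfolding e(7) by blast
  then show ?case by (simp add: deviation.minus_one)
next
  case (ordinal M \<alpha>)
  note f = ordinal.prems
  note e = right_epiD[OF f]
  show ?case
  proof (rule deviation.ordinal[OF ordinal.hyps(2)])
    fix C :: "nat \<Rightarrow> 'x set"
    assume C: "\<And>i. right_submodule R (C i) X" "\<And>i. B \<subseteq> C i" "\<And>i. C i \<subseteq> A" "\<And>i. C (Suc i) \<subseteq> C i"
    let ?D = "\<lambda>i. f ` C i"
    have D: "right_submodule R (?D i) M" for i by (rule right_epi_image_submodule[OF f C(1,3)])
    have DD: "?D (Suc i) \<subseteq> ?D i" for i using C(4) by blast
    have vD: "{x \<in> A. f x \<in> ?D i} = C i" for i by (rule right_epi_vimage_image[OF f C(1,3,2)])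
    from ordinal.IH[of ?D, OF D DD] obtain n where n: "\<forall>i\<ge>n. \<exists>\<beta> (Q :: ('a, 'm) right_mod). kord_less \<beta> (Some \<alpha>) \<and>
        (krull_class R \<beta> Q \<and> (\<forall>A f B. right_epi R X A Q f B \<longrightarrow> deviation R X \<beta> A B)) \<and>
        right_module_isomorphic R Q (quotient_module (M\<lparr>carrier := ?D i\<rparr>) (?D (Suc i)))" ..
    have "\<exists>\<beta>. kord_less \<beta> (Some \<alpha>) \<and> deviation R X \<beta> (C i) (C (Suc i))" if i: "i \<ge> n" for i
    proof -
      let ?Q = "quotient_module (M\<lparr>carrier := ?D i\<rparr>) (?D (Suc i))"
      obtain \<beta> and Q :: "('a, 'm) right_mod" where Q: "kord_less \<beta> (Some \<alpha>)" "krull_class R \<beta> Q"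
        "\<And>A f B. right_epi R X A Q f B \<Longrightarrow> deviation R X \<beta> A B" "right_module_isomorphic R Q ?Q"
        using n[THEN spec, THEN mp, OF i] by blast
      have q: "right_epi R M (?D i) ?Q (\<lambda>x. ?D (Suc i) +>\<^bsub>M\<^esub> x) (?D (Suc i))"
        by (rule right_epi_quotient[OF e(3) D D DD])
      note mQ = krull_class_right_module[OF Q(2)]
      \<comment> \<open>The copy Q of the factor is thereby presented by X with domain C i and
        kernel C (Suc i), so the induction hypothesis applies to it.\<close>
      obtain g where "right_epi R X {x \<in> A. f x \<in> ?D i} Q g {x \<in> A. f x \<in> ?D (Suc i)}"
        using right_epi_isomorphic[OF right_epi_comp[OF f q] mQ
            right_module_isomorphic_sym[OF mQ right_epiD(3)[OF q] Q(4)]] .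
      then show ?thesis using Q(1,3) unfolding vD by blast
    qed
    then show "\<exists>n. \<forall>i\<ge>n. \<exists>\<beta>. kord_less \<beta> (Some \<alpha>) \<and> deviation R X \<beta> (C i) (C (Suc i))" by blast
  qed
qed

text \<open>Chains of M pull back to chains between B and A. What remains is to realise each factor
  over the element type of M.\<close>

lemma deviation_imp_krull_class:
  fixes X :: "('a, 'x, 'l) right_mod_scheme" and M :: "('a, 'm) right_mod"
  assumes "deviation R X \<alpha> A B" "right_epi R X A M f B"
  shows "krull_class R \<alpha> M"
  using assms
proof (induction arbitrary: M f rule: deviation.induct)
  case (minus_one A)
  note e = right_epiD[OF minus_one.prems]
  have "f x = \<zero>\<^bsub>M\<^esub>" if "x \<in> A" for x using e(7) that by blast
  moreover have "\<zero>\<^bsub>X\<^esub> \<in> A" by (rule right_submodule_closed(1)[OF e(1,2)])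
  ultimately have "f ` A = {\<zero>\<^bsub>M\<^esub>}" by (auto intro: rev_image_eqI)
  then show ?case using e(3,4) by (intro krull_class.minus_one) (simp_all add: zero_module_def)
next
  case (ordinal \<alpha> B A)
  note f = ordinal.prems
  note e = right_epiD[OF f]
  show ?case
  proof (rule krull_class.ordinal[OF e(3) ordinal.hyps(1)])
    fix C :: "nat \<Rightarrow> 'm set"
    assume C: "\<And>i. right_submodule R (C i) M" "\<And>i. C (Suc i) \<subseteq> C i"
    let ?D = "\<lambda>i. {x \<in> A. f x \<in> C i}"
    have D: "right_submodule R (?D i) X" for i by (rule right_epi_vimage_submodule[OF f C(1)])
    have BD: "B \<subseteq> ?D i" for i using right_submodule_closed(1)[OF e(3) C(1)] unfolding e(7) by auto
    have DA: "?D i \<subseteq> A" for i by blast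
    have DD: "?D (Suc i) \<subseteq> ?D i" for i using C(2) by blast
    from ordinal.IH[of ?D, OF D BD DA DD] obtain n where n: "\<forall>i\<ge>n. \<exists>\<beta>. kord_less \<beta> (Some \<alpha>) \<and> deviation R X \<beta> (?D i) (?D (Suc i)) \<and>
        (\<forall>(M :: ('a, 'm) right_mod) f. right_epi R X (?D i) M f (?D (Suc i)) \<longrightarrow> krull_class R \<beta> M)" ..
    have "\<exists>\<beta> (Q :: ('a, 'm) right_mod). kord_less \<beta> (Some \<alpha>) \<and> krull_class R \<beta> Q \<and>
        right_module_isomorphic R Q (quotient_module (M\<lparr>carrier := C i\<rparr>) (C (Suc i)))" if i: "i \<ge> n" for i
    proof -
      let ?Q = "quotient_module (M\<lparr>carrier := C i\<rparr>) (C (Suc i))" and ?q = "\<lambda>x. C (Suc i) +>\<^bsub>M\<^esub> x"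
      have q: "right_epi R M (C i) ?Q ?q (C (Suc i))"
        by (rule right_epi_quotient[OF e(3) C(1) C(1) C(2)])
      \<comment> \<open>Choosing a representative in M from each coset is injective, and so gives a
        copy T of the factor over the element type of M.\<close>
      define \<phi> where "\<phi> S = (SOME x. x \<in> C i \<and> ?q x = S)" for S
      have "?q (\<phi> S) = S" if S: "S \<in> carrier ?Q" for S
      proof -
        have "S \<in> ?q ` C i" using S unfolding right_epiD(4)[OF q] .
        then have "\<exists>x. x \<in> C i \<and> ?q x = S" by blast
        from someI_ex[OF this] show ?thesis unfolding \<phi>_def by (rule conjunct2)
      qed
      then have "inj_on \<phi> (carrier ?Q)" by (rule inj_on_inverseI)
      then obtain T :: "('a, 'm) right_mod" where T: "right_epi R ?Q (carrier ?Q) T \<phi> {\<zero>\<^bsub>?Q\<^esub>}"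
        using right_module_copy[OF right_epiD(3)[OF q]] by blast
      have fq: "right_epi R X (?D i) ?Q (?q \<circ> f) (?D (Suc i))" by (rule right_epi_comp[OF f q])
      have "{x \<in> ?D i. (?q \<circ> f) x \<in> carrier ?Q} = ?D i" using right_epiD(8)[OF fq] by blast
      moreover have "{x \<in> ?D i. (?q \<circ> f) x \<in> {\<zero>\<^bsub>?Q\<^esub>}} = ?D (Suc i)"
        using right_epiD(7)[OF fq] by (simp only: singleton_iff)
      ultimately have fT: "right_epi R X (?D i) T (\<phi> \<circ> (?q \<circ> f)) (?D (Suc i))"
        using right_epi_comp[OF fq T] by (simp only:)
      obtain \<beta> where "kord_less \<beta> (Some \<alpha>)" "krull_class R \<beta> T" using n[THEN spec, THEN mp, OF i] fT by blast
      then show ?thesis using right_epi_iso[OF fT fq] by blast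
    qed
    then show "\<exists>n. \<forall>i\<ge>n. \<exists>\<beta> (Q :: ('a, 'm) right_mod). kord_less \<beta> (Some \<alpha>) \<and> krull_class R \<beta> Q \<and>
        right_module_isomorphic R Q (quotient_module (M\<lparr>carrier := C i\<rparr>) (C (Suc i)))" by blast
  qed
qed

lemma krull_class_iff_deviation:
  "right_epi R X A M f B \<Longrightarrow> krull_class R \<alpha> M \<longleftrightarrow> deviation R X \<alpha> A B"
  using krull_class_imp_deviation deviation_imp_krull_class by blast

section \<open>Exact deviation and critical factors\<close>

definition has_deviation ::
    "('a, 'k) ring_scheme \<Rightarrow> ('a, 'x, 'l) right_mod_scheme \<Rightarrow> 'o rel option \<Rightarrow> 'x set \<Rightarrow> 'x set \<Rightarrow> bool" where
  "has_deviation R X \<alpha> A B \<longleftrightarrow>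
     deviation R X \<alpha> A B \<and> (\<forall>\<beta>. kord_less \<beta> \<alpha> \<longrightarrow> \<not> deviation R X \<beta> A B)"

definition critical_factor ::
    "('a, 'k) ring_scheme \<Rightarrow> ('a, 'x, 'l) right_mod_scheme \<Rightarrow> 'o rel \<Rightarrow> 'x set \<Rightarrow> 'x set \<Rightarrow> bool" where
  "critical_factor R X \<alpha> A B \<longleftrightarrow>
     has_deviation R X (Some \<alpha>) A B \<and>
     (\<forall>N. right_submodule R N X \<and> B \<subset> N \<and> N \<subseteq> A \<longrightarrow>
        (\<exists>\<beta>. has_deviation R X \<beta> A N \<and> kord_less \<beta> (Some \<alpha>)))"

lemma has_krull_dim_iff:
  "right_epi R X A M f B \<Longrightarrow> has_krull_dim R M \<alpha> \<longleftrightarrow> has_deviation R X \<alpha> A B"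
  by (simp add: has_krull_dim_def has_deviation_def krull_class_iff_deviation)

text \<open>Nonzero submodules of M correspond to submodules N of A strictly above B, and the
  quotient of M by the image of N is A/N.\<close>

lemma critical_of_dim_iff:
  fixes \<alpha> :: "'o rel"
  assumes f: "right_epi R X A M f B"
  shows "critical_of_dim R M \<alpha> \<longleftrightarrow> critical_factor R X \<alpha> A B"
proof -
  note e = right_epiD[OF f]
  have quot: "has_krull_dim R (quotient_module M N) \<beta> \<longleftrightarrow> has_deviation R X \<beta> A {x \<in> A. f x \<in> N}"
    if "right_submodule R N M" for N and \<beta> :: "'o rel option"
  proof -
    have "{x \<in> A. f x \<in> carrier M} = A" using e(8) by blast
    then show ?thesis
      using has_krull_dim_iff[OF right_epi_comp[OF f right_epi_quotient_full[OF e(3) that]]] by simp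
  qed
  have "(\<forall>N. right_submodule R N M \<and> N \<noteq> {\<zero>\<^bsub>M\<^esub>} \<longrightarrow>
        (\<exists>\<beta>. has_krull_dim R (quotient_module M N) \<beta> \<and> kord_less \<beta> (Some \<alpha>))) \<longleftrightarrow>
     (\<forall>N. right_submodule R N X \<and> B \<subset> N \<and> N \<subseteq> A \<longrightarrow>
        (\<exists>\<beta>. has_deviation R X \<beta> A N \<and> kord_less \<beta> (Some \<alpha>)))" (is "?l \<longleftrightarrow> ?r")
  proof (intro iffI allI impI)
    fix N assume l: ?l and N: "right_submodule R N X \<and> B \<subset> N \<and> N \<subseteq> A"
    then have v: "{x \<in> A. f x \<in> f ` N} = N" by (intro right_epi_vimage_image[OF f]) auto
    have s: "right_submodule R (f ` N) M" using N by (intro right_epi_image_submodule[OF f]) auto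
    obtain x where "x \<in> N" "x \<notin> B" "x \<in> A" using N by blast
    then have "f x \<in> f ` N" "f x \<noteq> \<zero>\<^bsub>M\<^esub>" unfolding e(7) by auto
    then have "f ` N \<noteq> {\<zero>\<^bsub>M\<^esub>}" by blast
    then show "\<exists>\<beta>. has_deviation R X \<beta> A N \<and> kord_less \<beta> (Some \<alpha>)"
      using l s quot[OF s] unfolding v by blast
  next
    fix N assume r: ?r and N: "right_submodule R N M \<and> N \<noteq> {\<zero>\<^bsub>M\<^esub>}"
    let ?N = "{x \<in> A. f x \<in> N}"
    have i: "f ` ?N = N" using N by (intro right_epi_image_vimage[OF f]) auto
    have s: "right_submodule R ?N X" using N by (intro right_epi_vimage_submodule[OF f]) auto
    have z: "\<zero>\<^bsub>M\<^esub> \<in> N" using N right_submodule_closed(1)[OF e(3)] by blast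
    then obtain y where "y \<in> N" "y \<noteq> \<zero>\<^bsub>M\<^esub>" using N by blast
    moreover from this obtain x where "x \<in> ?N" "y = f x" using i by blast
    ultimately have "?N \<noteq> B" unfolding e(7) by blast
    moreover have "B \<subseteq> ?N" unfolding e(7) using z by auto
    ultimately show "\<exists>\<beta>. has_krull_dim R (quotient_module M N) \<beta> \<and> kord_less \<beta> (Some \<alpha>)"
      using r s N quot[of N] by blast
  qed
  then show ?thesis
    unfolding critical_of_dim_def critical_factor_def using has_krull_dim_iff[OF f] by blast
qed

section \<open>Existence of deviations and of critical factors\<close>

lemma deviation_mono:
  fixes X :: "('a, 'x, 'l) right_mod_scheme"
  assumes "deviation R X \<alpha> A B" "B \<subseteq> A'" "A' \<subseteq> A"
  shows "deviation R X \<alpha> A' B"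
proof (cases \<alpha>)
  case None
  then have "A = B" using assms(1) by (auto elim: deviation_NoneE)
  then show ?thesis using assms None by (metis subset_antisym)
next
  case (Some s)
  from assms(1)[unfolded Some] show ?thesis
    unfolding Some
  proof (rule deviation_SomeE)
    assume s: "Well_order s"
      and chain: "\<And>C :: nat \<Rightarrow> 'x set.
         \<lbrakk>\<And>i. right_submodule R (C i) X; \<And>i. B \<subseteq> C i; \<And>i. C i \<subseteq> A; \<And>i. C (Suc i) \<subseteq> C i\<rbrakk>
         \<Longrightarrow> \<exists>n. \<forall>i\<ge>n. \<exists>\<beta>. kord_less \<beta> (Some s) \<and> deviation R X \<beta> (C i) (C (Suc i))"
    show "deviation R X (Some s) A' B"
      by (rule deviation.ordinal[OF s]) (rule chain, use subset_trans[OF _ assms(3)] in auto)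
  qed
qed

lemma has_deviation_exists:
  assumes "deviation R X \<alpha> A B"
  obtains \<beta> where "has_deviation R X \<beta> A B" "\<beta> = \<alpha> \<or> kord_less \<beta> \<alpha>"
proof -
  let ?K = "{\<beta>. deviation R X \<beta> A B \<and> (\<beta> = \<alpha> \<or> kord_less \<beta> \<alpha>)}"
  have "\<alpha> \<in> ?K" using assms by simp
  from wfE_min[OF wf_kord_less this] obtain \<beta> where \<beta>: "\<beta> \<in> ?K"
    "\<And>\<gamma>. (\<gamma>, \<beta>) \<in> {(\<beta>, \<alpha>). kord_less \<beta> \<alpha>} \<Longrightarrow> \<gamma> \<notin> ?K" by blast
  have "\<not> deviation R X \<gamma> A B" if "kord_less \<gamma> \<beta>" for \<gamma>
    using \<beta>(1) \<beta>(2)[of \<gamma>] that kord_less_trans[OF that] by auto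
  then show ?thesis using that[of \<beta>] \<beta>(1) unfolding has_deviation_def by blast
qed

text \<open>If a chain reaches B, its later factors are zero. If it never does, every C (Suc i) is
  strictly above B, hence of smaller rank, and that rank bounds the deviation of C i over C (Suc i)
  by induction. All ranks live on the type \<open>'x set set\<close>.\<close>

lemma deviation_exists:
  fixes X :: "('a, 'x, 'l) right_mod_scheme"
  assumes wf: "wf {(J, I). right_submodule R J X \<and> I0 \<subseteq> I \<and> I \<subset> J}"
    and "I0 \<subseteq> B"
  obtains \<alpha> :: "'x set set rel option" where "deviation R X \<alpha> A B"
proof -
  let ?r = "{(J, I). right_submodule R J X \<and> I0 \<subseteq> I \<and> I \<subset> J}"
  obtain \<rho> :: "'x set \<Rightarrow> 'x set set rel"
    where \<rho>: "\<And>x. Well_order (\<rho> x)" "\<And>x y. (y, x) \<in> ?r \<Longrightarrow> (\<rho> y, \<rho> x) \<in> ordLess"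
    using wf_rank[OF wf] by blast
  have "deviation R X (Some (\<rho> B)) A B"
    using wf assms(2)
  proof (induction B arbitrary: A rule: wf_induct_rule)
    case (less B)
    show ?case
    proof (rule deviation.ordinal[OF \<rho>(1)])
      fix C :: "nat \<Rightarrow> 'x set"
      assume C: "\<And>i. right_submodule R (C i) X" "\<And>i. B \<subseteq> C i" "\<And>i. C i \<subseteq> A" "\<And>i. C (Suc i) \<subseteq> C i"
      show "\<exists>n. \<forall>i\<ge>n. \<exists>\<beta>. kord_less \<beta> (Some (\<rho> B)) \<and> deviation R X \<beta> (C i) (C (Suc i))"
      proof (cases "\<exists>n. C n = B")
        case True
        then obtain n where n: "C n = B" ..
        have "C i = B" if "i \<ge> n" for i
          using lift_Suc_antimono_le[of C, OF C(4) that] n C(2) by blast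
        then have "C i = B \<and> C (Suc i) = B" if "i \<ge> n" for i using that by simp
        moreover have "kord_less None (Some (\<rho> B))" using \<rho>(1) by (simp add: kord_less_def)
        ultimately show ?thesis using deviation.minus_one by metis
      next
        case False
        have "kord_less (Some (\<rho> (C (Suc i)))) (Some (\<rho> B)) \<and>
            deviation R X (Some (\<rho> (C (Suc i)))) (C i) (C (Suc i))" for i
        proof -
          have 1: "(C (Suc i), B) \<in> ?r" using C(1,2) False less.prems by auto
          then show ?thesis
            using less.IH[OF 1] \<rho>(2)[OF 1] less.prems C(2) by (auto simp: kord_less_def)
        qed
        then show ?thesis by blast
      qed
    qed
  qed
  then show ?thesis using that by blast
qed

text \<open>
  Choose \<open>A/B\<close> nonzero of least possible deviation \<open>\<alpha>\<close>.  If no nonzero submodule of it were critical,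
  then one could descend forever with factors of deviation not below \<open>\<alpha>\<close>.
\<close>

lemma critical_factor_exists:
  fixes X :: "('a, 'x, 'l) right_mod_scheme"
  assumes wf: "wf {(J, I). right_submodule R J X \<and> B \<subseteq> I \<and> I \<subset> J}"
    and A0: "right_submodule R A0 X" "B \<subset> A0"
  obtains \<alpha> :: "'x set set rel" and A where "right_submodule R A X" "B \<subset> A"
    "\<And>D. right_submodule R D X \<Longrightarrow> B \<subset> D \<Longrightarrow> D \<subseteq> A \<Longrightarrow> critical_factor R X \<alpha> D B"
proof -
  let ?P = "\<lambda>A. right_submodule R A X \<and> B \<subset> A"
  let ?K = "{\<alpha> :: 'x set set rel option. \<exists>A. ?P A \<and> deviation R X \<alpha> A B}"
  obtain \<alpha>0 :: "'x set set rel option" where "deviation R X \<alpha>0 A0 B"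
    using deviation_exists[OF wf subset_refl] .
  then have "\<alpha>0 \<in> ?K" using A0 by blast
  from wfE_min[OF wf_kord_less this] obtain \<alpha> where \<alpha>: "\<alpha> \<in> ?K"
    and min: "\<And>\<beta>. (\<beta>, \<alpha>) \<in> {(\<beta>, \<alpha>). kord_less \<beta> \<alpha>} \<Longrightarrow> \<beta> \<notin> ?K" by blast
  then obtain A1 where A1: "?P A1" "deviation R X \<alpha> A1 B" by blast
  then obtain s where s: "\<alpha> = Some s" by (cases \<alpha>) (auto elim: deviation_NoneE)
  \<comment> \<open>A submodule D of A1 has deviation at most \<open>s\<close>, and the minimal
    choice of \<open>s\<close> excludes anything smaller as long as D is strictly above B.\<close>
  have dev: "has_deviation R X (Some s) D B" if "?P D" "D \<subseteq> A1" for D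
    using deviation_mono[OF A1(2), of D] min that unfolding has_deviation_def s by blast
  \<comment> \<open>Only some bound below \<open>s\<close> is asked for, since a bound passes to
    smaller intervals; the exact deviation is recovered afterwards by
    \<open>has_deviation_exists\<close>.\<close>
  define low where "low A N \<longleftrightarrow> (\<exists>\<beta>. deviation R X \<beta> A N \<and> kord_less \<beta> (Some s))" for A N
  have "\<exists>A. (?P A \<and> A \<subseteq> A1) \<and> (\<forall>N. ?P N \<and> N \<subseteq> A \<longrightarrow> low A N)"
  proof (rule ccontr)
    assume "\<not> ?thesis"
    then have "\<forall>A. \<exists>N. ?P A \<and> A \<subseteq> A1 \<longrightarrow> ?P N \<and> N \<subseteq> A \<and> \<not> low A N" by blast
    from choice[OF this] obtain g
      where g: "\<forall>A. ?P A \<and> A \<subseteq> A1 \<longrightarrow> ?P (g A) \<and> g A \<subseteq> A \<and> \<not> low A (g A)" ..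
    define C where "C i = (g ^^ i) A1" for i
    have CS: "C (Suc i) = g (C i)" for i by (simp add: C_def)
    have C: "?P (C i) \<and> C i \<subseteq> A1" for i
    proof (induction i)
      case 0
      then show ?case using A1 by (simp add: C_def)
    next
      case (Suc i)
      then show ?case using g[THEN spec, of "C i"] unfolding CS by blast
    qed
    from A1(2)[unfolded s] obtain n where
      "\<forall>i\<ge>n. \<exists>\<beta>. kord_less \<beta> (Some s) \<and> deviation R X \<beta> (C i) (C (Suc i))"
    proof (rule deviation_SomeE)
      assume chain: "\<And>C :: nat \<Rightarrow> 'x set.
         \<lbrakk>\<And>i. right_submodule R (C i) X; \<And>i. B \<subseteq> C i; \<And>i. C i \<subseteq> A1; \<And>i. C (Suc i) \<subseteq> C i\<rbrakk>
         \<Longrightarrow> \<exists>n. \<forall>i\<ge>n. \<exists>\<beta>. kord_less \<beta> (Some s) \<and> deviation R X \<beta> (C i) (C (Suc i))"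
      have "\<exists>n. \<forall>i\<ge>n. \<exists>\<beta>. kord_less \<beta> (Some s) \<and> deviation R X \<beta> (C i) (C (Suc i))"
      proof (rule chain)
        show "C (Suc i) \<subseteq> C i" for i using g[THEN spec, of "C i"] C[of i] unfolding CS by blast
      qed (use C in blast)+
      then show ?thesis using that by blast
    qed
    then have "low (C n) (C (Suc n))" unfolding low_def by blast
    then show False using g[THEN spec, of "C n"] C[of n] unfolding CS by blast
  qed
  then obtain A where A: "?P A" "A \<subseteq> A1" and crit: "\<forall>N. ?P N \<and> N \<subseteq> A \<longrightarrow> low A N"
    by (elim exE conjE) blast
  \<comment> \<open>Shrinking A to D keeps deviation \<open>s\<close> over B by minimality and can
    only lower the deviation over N.\<close>
  have "critical_factor R X s D B" if D: "right_submodule R D X" "B \<subset> D" "D \<subseteq> A" for D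
    unfolding critical_factor_def
  proof (intro conjI allI impI)
    show "has_deviation R X (Some s) D B" using dev D A by blast
    fix N assume N: "right_submodule R N X \<and> B \<subset> N \<and> N \<subseteq> D"
    then have "low A N" using crit D by blast
    then obtain \<beta> where \<beta>: "deviation R X \<beta> A N" "kord_less \<beta> (Some s)" unfolding low_def by blast
    then have "deviation R X \<beta> D N" using deviation_mono N D by blast
    then obtain \<gamma> where "has_deviation R X \<gamma> D N" "\<gamma> = \<beta> \<or> kord_less \<gamma> \<beta>"
      using has_deviation_exists by blast
    then show "\<exists>\<beta>. has_deviation R X \<beta> D N \<and> kord_less \<beta> (Some s)"
      using \<beta>(2) kord_less_trans by blast
  qed
  then show ?thesis using that A by blast
qed

text \<open>This moves the study of mR to the right ideals above ann(m), whatever the element type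
  of M.\<close>

lemma right_epi_cyclic:
  assumes M: "right_module R M" and m: "m \<in> carrier M"
  defines "U \<equiv> (\<lambda>r. m \<triangleleft>\<^bsub>M\<^esub> r) ` carrier R"
  shows "right_submodule R U M"
    and "right_epi R (regular_module R) (carrier R) (M\<lparr>carrier := U\<rparr>) (\<lambda>r. m \<triangleleft>\<^bsub>M\<^esub> r) (annihilator R M m)"
proof -
  interpret right_module R M by (fact M)
  note X = right_module_regular[OF R.ring_axioms]
  have "m \<triangleleft>\<^bsub>M\<^esub> \<zero>\<^bsub>R\<^esub> \<oplus>\<^bsub>M\<^esub> m \<triangleleft>\<^bsub>M\<^esub> \<zero>\<^bsub>R\<^esub> = m \<triangleleft>\<^bsub>M\<^esub> \<zero>\<^bsub>R\<^esub>"
    using ract_add_right[OF m, of "\<zero>\<^bsub>R\<^esub>" "\<zero>\<^bsub>R\<^esub>"] by simp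
  then have "m \<triangleleft>\<^bsub>M\<^esub> \<zero>\<^bsub>R\<^esub> = \<zero>\<^bsub>M\<^esub>"
    using ract_closed[OF m, of "\<zero>\<^bsub>R\<^esub>"] M.add.r_cancel_one by blast
  then have "\<zero>\<^bsub>M\<^esub> \<in> U" unfolding U_def by (metis R.zero_closed imageI)
  then show U: "right_submodule R U M"
    using m by (intro right_submoduleI[OF M])
      (auto simp: U_def ract_closed ract_add_right[symmetric] ract_mult[symmetric])
  show "right_epi R (regular_module R) (carrier R) (M\<lparr>carrier := U\<rparr>) (\<lambda>r. m \<triangleleft>\<^bsub>M\<^esub> r) (annihilator R M m)"
    by (rule right_epiI[OF X right_module_carrier_submodule[OF X, simplified] right_module_restrict[OF M U]])
      (use m in \<open>simp_all add: U_def annihilator_def ract_add_right ract_mult\<close>)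
qed

text \<open>A strictly ascending chain above ann(m) has images in mR that stabilise in M, and each
  right ideal above the kernel is recovered from its image.\<close>

lemma wf_right_ideals_above_annihilator:
  assumes noeth: "noetherian_right_module R M" and m: "m \<in> carrier M"
  shows "wf {(J, I). right_submodule R J (regular_module R) \<and> annihilator R M m \<subseteq> I \<and> I \<subset> J}"
  unfolding wf_iff_no_infinite_down_chain
proof
  assume "\<exists>f. \<forall>i. (f (Suc i), f i)
    \<in> {(J, I). right_submodule R J (regular_module R) \<and> annihilator R M m \<subseteq> I \<and> I \<subset> J}"
  then obtain f where "\<forall>i. (f (Suc i), f i)
    \<in> {(J, I). right_submodule R J (regular_module R) \<and> annihilator R M m \<subseteq> I \<and> I \<subset> J}" ..
  \<comment> \<open>The relation makes only the larger member of a pair a right ideal, so nothing is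
    known of f 0 and the chain is used from index 1 on.\<close>
  then have f: "\<And>i. right_submodule R (f (Suc i)) (regular_module R)"
    "\<And>i. annihilator R M m \<subseteq> f i" "\<And>i. f i \<subset> f (Suc i)" by simp_all
  have M: "right_module R M" using noeth by (simp add: noetherian_right_module_def)
  define U where "U = (\<lambda>r. m \<triangleleft>\<^bsub>M\<^esub> r) ` carrier R"
  define g where "g r = m \<triangleleft>\<^bsub>M\<^esub> r" for r
  note cyc = right_epi_cyclic[OF M m, folded U_def, folded g_def]
  have sub: "f (Suc i) \<subseteq> carrier R" for i
    using right_submodule_closed(2)[OF right_epiD(1)[OF cyc(2)] f(1)] by simp
  have "right_submodule R (g ` f (Suc i)) M" for i
    using right_epi_image_submodule[OF cyc(2) f(1) sub] right_submodule_restrict[OF M cyc(1)] by blast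
  moreover have "g ` f (Suc i) \<subseteq> g ` f (Suc (Suc i))" for i using f(3)[of "Suc i"] by blast
  ultimately obtain n where n: "\<forall>i\<ge>n. g ` f (Suc i) = g ` f (Suc n)"
    using noeth unfolding noetherian_right_module_def
    by (elim conjE allE[of _ "\<lambda>i. g ` f (Suc i)"]) auto
  have "g ` f (Suc (Suc n)) = g ` f (Suc n)" by (rule n[rule_format]) simp
  moreover have "{x \<in> carrier R. g x \<in> g ` f (Suc i)} = f (Suc i)" for i
    by (rule right_epi_vimage_image[OF cyc(2) f(1) sub f(2)])
  ultimately have "f (Suc (Suc n)) = f (Suc n)" by metis
  then show False using f(3)[of "Suc n"] by blast
qed

section \<open>Cocritical right ideals as a point annihilator set\<close>

context ring
begin

lemma cocritical_right_noetherian_point_annihilator_set: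
  "right_noetherian_point_annihilator_set R {I. cocritical_right_ideal I R}"
  unfolding right_noetherian_point_annihilator_set_def
proof (intro conjI allI impI)
  show "\<forall>I\<in>{I. cocritical_right_ideal I R}. right_ideal I R" by (simp add: cocritical_right_ideal_def)
  fix M :: "('a, (nat \<Rightarrow> 'a) set) right_mod"
  assume "noetherian_right_module R M \<and> \<not> zero_module M"
  then have noeth: "noetherian_right_module R M" and nz: "\<not> zero_module M" by auto
  have M: "right_module R M" using noeth by (simp add: noetherian_right_module_def)
  interpret M: right_module R M by (fact M)
  let ?X = "regular_module R"
  note X = right_module_regular[OF ring_axioms]
  obtain m where m: "m \<in> carrier M" "m \<noteq> \<zero>\<^bsub>M\<^esub>"
    using nz M.M.zero_closed unfolding zero_module_def by blast
  let ?I = "annihilator R M m"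
  have I: "right_submodule R ?I ?X" "?I \<subseteq> carrier R"
    using right_epi_kernel_submodule[OF right_epi_cyclic(2)[OF M m(1)]] .
  then have rI: "right_ideal ?I R" by (simp add: right_ideal_def)
  have "\<one> \<notin> ?I" using M.ract_one[OF m(1)] m(2) by (simp add: annihilator_def)
  then have lt: "?I \<subset> carrier R" using I(2) by blast
  obtain \<alpha> :: "'a set set rel" and A where A: "right_submodule R A ?X" "?I \<subset> A"
    and crit: "\<And>D. right_submodule R D ?X \<Longrightarrow> ?I \<subset> D \<Longrightarrow> D \<subseteq> A \<Longrightarrow> critical_factor R ?X \<alpha> D ?I"
    using critical_factor_exists[OF wf_right_ideals_above_annihilator[OF noeth m(1)]
        right_module_carrier_submodule[OF X, simplified] lt] by metis
  have rA: "right_ideal A R" using A(1) by (simp add: right_ideal_def)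
  obtain a where a: "a \<in> A" "a \<notin> ?I" using A(2) by blast
  then have aR: "a \<in> carrier R" using right_idealD(5)[OF rA] by blast
  \<comment> \<open>Over ann(m) this is the cyclic submodule of A/ann(m) generated by the coset of
    a; it is nonzero as a is outside ann(m), hence critical.\<close>
  let ?D = "?I <+>\<^bsub>R\<^esub> right_multiples R a" and ?J = "right_colon R a ?I"
  note D = right_ideal_sum[OF rI right_ideal_multiples[OF aR]]
  have sD: "right_submodule R ?D ?X" using D(1) by (simp add: right_ideal_def)
  have "critical_factor R ?X \<alpha> ?D ?I"
  proof (rule crit[OF sD])
    show "?I \<subset> ?D" using D(2,3) mem_multiples_self[OF aR] a(2) by blast
    show "?D \<subseteq> A" using right_ideal_sum_subset[OF rA _ right_multiples_subset[OF rA a(1)]] A(2) by blast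
  qed
  then have "critical_of_dim R (quotient_module (?X\<lparr>carrier := ?D\<rparr>) ?I) \<alpha>"
    using critical_of_dim_iff[OF right_epi_quotient[OF X sD I(1) D(2)]] by blast
  \<comment> \<open>The same quotient is read through two presentations: as D over ann(m), and as R
    over a^{-1}ann(m), which is the annihilator of ma.\<close>
  then have "critical_factor R ?X \<alpha> (carrier R) ?J"
    using critical_of_dim_iff[OF right_epi_colon[OF rI aR]] by blast
  moreover have rJ: "right_ideal ?J R" by (rule right_ideal_colon[OF rI aR])
  ultimately have "cocritical_right_ideal ?J R"
    unfolding cocritical_right_ideal_def
    using critical_of_dim_iff[OF right_epi_regular_quotient[OF rJ]] by blast
  moreover have "?J = annihilator R M (m \<triangleleft>\<^bsub>M\<^esub> a)"
    unfolding right_colon_def annihilator_def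
    by (rule Collect_cong) (use aR M.ract_mult[OF m(1) aR] in force)
  moreover have "m \<triangleleft>\<^bsub>M\<^esub> a \<in> carrier M - {\<zero>\<^bsub>M\<^esub>}"
    using m(1) aR a(2) M.ract_closed by (simp add: annihilator_def)
  ultimately show "\<exists>I\<in>point_annihilators R M. I \<in> {I. cocritical_right_ideal I R}"
    unfolding point_annihilators_def by blast
qed

text \<open>The isomorphism presents R/I by R with kernel J, so criticality of R/I and of R/J is one
  and the same condition on the pair (R, J).\<close>

lemma cocritical_closed_under_similarity:
  "closed_under_similarity R {I. cocritical_right_ideal I R}"
  unfolding closed_under_similarity_def
proof (intro ballI allI impI)
  fix I J assume I: "I \<in> {I. cocritical_right_ideal I R}" and sim: "similar_right_ideals R J I"
  let ?X = "regular_module R"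
  have r: "right_ideal J R" "right_ideal I R"
    and iso: "right_module_isomorphic R (quotient_module ?X J) (quotient_module ?X I)"
    using sim by (simp_all add: similar_right_ideals_def)
  note qJ = right_epi_regular_quotient[OF r(1)] and qI = right_epi_regular_quotient[OF r(2)]
  obtain g where g: "right_epi R ?X (carrier R) (quotient_module ?X I) g J"
    using right_epi_isomorphic[OF qJ right_epiD(3)[OF qI] iso] .
  obtain \<alpha> :: "'a set set rel" where "critical_of_dim R (quotient_module ?X I) \<alpha>"
    using I by (auto simp: cocritical_right_ideal_def)
  then have "critical_of_dim R (quotient_module ?X J) \<alpha>"
    unfolding critical_of_dim_iff[OF g] critical_of_dim_iff[OF qJ] .
  then show "J \<in> {I. cocritical_right_ideal I R}" using r by (auto simp: cocritical_right_ideal_def)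
qed

end

text \<open>The last two conjuncts justify the example named in the claim, so that the equivalence
  applies to the set of cocritical right ideals.\<close>

theorem theorem6p11:
  fixes R :: "('a, 'k) ring_scheme"
  assumes "ring R"
  shows
    "(\<forall>S. right_noetherian_point_annihilator_set R S \<and> closed_under_similarity R S \<longrightarrow>
        (principal_right_ideal_ring R \<longleftrightarrow>
           (\<forall>I. essential_right_ideal I R \<and> I \<in> S \<longrightarrow> principal_right_ideal I R))) \<and>
     right_noetherian_point_annihilator_set R {I. cocritical_right_ideal I R} \<and>
     closed_under_similarity R {I. cocritical_right_ideal I R}"
proof -
  interpret ring R by (fact assms)
  have "principal_right_ideal_ring R \<longleftrightarrow>
      (\<forall>I. essential_right_ideal I R \<and> I \<in> S \<longrightarrow> principal_right_ideal I R)"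
    if "right_noetherian_point_annihilator_set R S \<and> closed_under_similarity R S" for S
    using that principal_right_ideal_ring_criterion[of S]
    unfolding principal_right_ideal_ring_def[of R] essential_right_ideal_iff by blast
  then show ?thesis
    using cocritical_right_noetherian_point_annihilator_set cocritical_closed_under_similarity
    by blast
qed

end
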